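(* Suppose $f+R$ satisfies the Kurdyka–Łojasiewicz condition with exponent $1/2$ and constant $\mu>0$: for every $x\in\mathbb{R}^d$ and every $u\in\partial R(x)$, $\|\nabla f(x)+u\|^2\ge2\mu\big(f(x)+R(x)-f^\star-R^\star\big)$, where $f^\star=f(x^\star)$, $R^\star=R(x^\star)$ for a minimizer $x^\star$ of $f+R$. In EF-BV, suppose $\nu\in(0,1]$, $\lambda\in(0,1]$ is such that $r<1$, and $$0<\gamma\le\frac{1}{2L+\tilde L\sqrt{\frac{r_{\mathrm{av}}}{r}}\frac{1}{s^\star}}.$$ For $t\ge0$ define $\Psi^t=f(x^t)+R(x^t)-f^\star-R^\star+\frac{\gamma}{2\theta^\star}\frac1n\sum_{i=1}^n\|\nabla f_i(x^t)-h_i^t\|^2$. Then for every $t\ge0$, $$\mathbb{E}[\Psi^t]\le\Big(\max\Big(\frac{1}{1+\frac12\gamma\mu},\frac{r+1}{2}\Big)\Big)^t\Psi^0.$$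
   Context: Problem setting: $f=\frac1n\sum_{i=1}^nf_i$, where each $f_i:\mathbb{R}^d\to\mathbb{R}$ is convex and $L_i$-smooth (differentiable with $L_i$-Lipschitz gradient); $\tilde L=\sqrt{\frac1n\sum_iL_i^2}$ and $f$ is $L$-smooth with $L\le\tilde L$; $R:\mathbb{R}^d\to\mathbb{R}\cup\{+\infty\}$ is proper closed convex, $\mathrm{prox}_{\gamma R}(x)=\arg\min_y(\gamma R(y)+\frac12\|x-y\|^2)$, and a minimizer of $f+R$ exists. For $\eta\in[0,1)$, $\omega\ge0$, $\mathbb{C}(\eta,\omega)$ is the class of randomized operators $\mathcal{C}:\mathbb{R}^d\to\mathbb{R}^d$ with $\|\mathbb{E}[\mathcal{C}(x)]-x\|\le\eta\|x\|$ and $\mathbb{E}\|\mathcal{C}(x)-\mathbb{E}[\mathcal{C}(x)]\|^2\le\omega\|x\|^2$ for all $x$. Compressors $\mathcal{C}_i^t$ ($i=1,\dots,n$, $t\ge0$) all lie in $\mathbb{C}(\eta,\omega)$; those used at iteration $t$ are independent of all randomness of previous iterations; $\omega_{\mathrm{av}}\in[0,\omega]$ satisfies, for every $t$ and all $x_1,\dots,x_n$, $\mathbb{E}\|\frac1n\sum_i(\mathcal{C}_i^t(x_i)-\mathbb{E}[\mathcal{C}_i^t(x_i)])\|^2\le\frac{\omega_{\mathrm{av}}}{n}\sum_i\|x_i\|^2$. Algorithm EF-BV: given $x^0,h_1^0,\dots,h_n^0$, $\gamma>0$, $\lambda,\nu\in(0,1]$, $h^0=\frac1n\sum_ih_i^0$;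 for $t\ge0$: $d_i^t=\mathcal{C}_i^t(\nabla f_i(x^t)-h_i^t)$, $h_i^{t+1}=h_i^t+\lambda d_i^t$, $d^t=\frac1n\sum_id_i^t$, $h^{t+1}=h^t+\lambda d^t$, $g^{t+1}=h^t+\nu d^t$, $x^{t+1}=\mathrm{prox}_{\gamma R}(x^t-\gamma g^{t+1})$. Constants: $r=(1-\lambda+\lambda\eta)^2+\lambda^2\omega$, $r_{\mathrm{av}}=(1-\nu+\nu\eta)^2+\nu^2\omega_{\mathrm{av}}$, $s^\star=\sqrt{\frac{1+r}{2r}}-1$, $\theta^\star=s^\star(1+s^\star)\frac{r}{r_{\mathrm{av}}}$ (with $r>0$ and $r_{\mathrm{av}}>0$ so these are finite and positive). *)

theory Defs
  imports "HOL-Analysis.Analysis" "HOL-Probability.Probability"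
begin

text \<open>The extended-valued proper closed convex function R is represented by its
effective domain D (nonempty, convex) and its finite values R on D; R is +infinity
outside D. Closedness = closedness of the epigraph.\<close>

definition epigraph_on :: "'a set \<Rightarrow> ('a \<Rightarrow> real) \<Rightarrow> ('a \<times> real) set" where
  "epigraph_on D R = {(x, s). x \<in> D \<and> R x \<le> s}"

definition proper_closed_convex :: "'a::euclidean_space set \<Rightarrow> ('a \<Rightarrow> real) \<Rightarrow> bool" where
  "proper_closed_convex D R \<longleftrightarrow> D \<noteq> {} \<and> convex D \<and> convex_on D R \<and> closed (epigraph_on D R)"

definition prox :: "real \<Rightarrow> 'a::euclidean_space set \<Rightarrow> ('a \<Rightarrow> real) \<Rightarrow> 'a \<Rightarrow> 'a" where
  "prox \<gamma> D R x = (THE y. y \<in> D \<and>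
     (\<forall>z\<in>D. \<gamma> * R y + (1/2) * (norm (x - y))\<^sup>2 \<le> \<gamma> * R z + (1/2) * (norm (x - z))\<^sup>2))"

definition subdiff :: "'a::euclidean_space set \<Rightarrow> ('a \<Rightarrow> real) \<Rightarrow> 'a \<Rightarrow> 'a set" where
  "subdiff D R x = (if x \<in> D then {u. \<forall>y\<in>D. R y \<ge> R x + inner u (y - x)} else {})"

definition compressor_class :: "'m measure \<Rightarrow> real \<Rightarrow> real \<Rightarrow> ('m \<Rightarrow> 'a::euclidean_space \<Rightarrow> 'a) \<Rightarrow> bool" where
  "compressor_class M \<eta> \<omega> Cop \<longleftrightarrow>
    (\<forall>x. integrable M (\<lambda>s. Cop s x) \<and>
         integrable M (\<lambda>s. (norm (Cop s x - (\<integral>s'. Cop s' x \<partial>M)))\<^sup>2) \<and>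
         norm ((\<integral>s. Cop s x \<partial>M) - x) \<le> \<eta> * norm x \<and>
         (\<integral>s. (norm (Cop s x - (\<integral>s'. Cop s' x \<partial>M)))\<^sup>2 \<partial>M) \<le> \<omega> * (norm x)\<^sup>2)"

end

theory Submission
  imports Defs
begin

text \<open>
  Let \<open>E(x)\<close> be the minimum over \<open>z\<close> of \<open>gap z + (norm (x - z))\<^sup>2 / (2 * \<gamma>)\<close>, the Moreau envelope of
  the suboptimality gap. The descent lemma, convexity of \<open>f\<close> and the subgradient supplied by the
  proximal step show that one step with error \<open>e\<close> from \<open>x\<close> to \<open>y\<close> satisfies
  \<open>gap y + b\<^sup>2 / (2 * \<gamma>) * (norm (y - x))\<^sup>2 \<le> E(x) + \<gamma> / 2 * (norm e)\<^sup>2\<close> whenever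
  \<open>2 * \<gamma> * L + b \<le> 1\<close>, and the KL inequality gives \<open>E(x) \<le> \<rho> * gap x\<close>. Applying KL directly at \<open>y\<close>
  instead would put the factor \<open>1 + \<gamma> * \<mu> / 2\<close> on \<open>gap y\<close> alone and lose it in the displacement
  term. The displacement term on the left pays for the drift of the gradients \<open>\<nabla>f\<^sub>i\<close>, so that
  what remains is \<open>\<gamma> / 2 * (norm e)\<^sup>2\<close> and the compression residuals; their means given the past
  are bounded by \<open>r_av\<close> and \<open>r\<close> times the mean squared distance between \<open>h\<^sub>i\<close> and \<open>\<nabla>f\<^sub>i\<close>.
\<close>

subsection \<open>Convex functions and proximal steps\<close>

text \<open>Serves to read off first-order inequalities along segments: after division by the step
  \<open>\<tau>\<close> an error \<open>\<tau> * K\<close> is left, and \<open>\<tau>\<close> tends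
  to 0. If \<open>a > b\<close>, a step with \<open>\<tau> * K \<le> (a - b) / 2\<close> contradicts
  the hypothesis.\<close>

lemma le_of_le_add_small:
  fixes a b K :: real
  assumes "\<And>\<tau>. 0 < \<tau> \<Longrightarrow> \<tau> \<le> 1 \<Longrightarrow> a \<le> b + \<tau> * K"
  shows "a \<le> b"
proof (rule ccontr)
  assume ab: "\<not> a \<le> b"
  define \<tau> where "\<tau> = min 1 ((a - b) / (2 * (\<bar>K\<bar> + 1)))"
  have \<tau>: "0 < \<tau>" "\<tau> \<le> 1" "\<tau> \<le> (a - b) / (2 * (\<bar>K\<bar> + 1))"
    using ab by (auto simp: \<tau>_def)
  have "\<tau> * K \<le> \<tau> * (\<bar>K\<bar> + 1)"
    using \<tau>(1) by (intro mult_left_mono) auto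
  also have "\<dots> \<le> (a - b) / 2"
    using \<tau>(3) by (simp add: field_simps)
  finally have "a - b \<le> (a - b) / 2"
    using assms[OF \<tau>(1,2)] by linarith
  then show False
    using ab by simp
qed

text \<open>The claim is \<open>\<psi> 1 \<le> \<psi> 0\<close>, where \<open>\<psi>\<close> is
  \<open>f\<close> on the segment minus the linear and quadratic terms of its model. Cauchy-Schwarz
  and the Lipschitz bound make the derivative of \<open>\<psi>\<close> nonpositive on the unit
  interval.\<close>

lemma descent_lemma:
  fixes f :: "'a::real_inner \<Rightarrow> real"
  assumes grad: "\<And>y. GDERIV f y :> g y"
    and lip: "\<And>y z. norm (g y - g z) \<le> L * norm (y - z)"
  shows "f (x + v) \<le> f x + inner (g x) v + L / 2 * (norm v)\<^sup>2"
proof -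
  define \<psi> where "\<psi> t = f (x + t *\<^sub>R v) - t * inner (g x) v - L / 2 * t\<^sup>2 * (norm v)\<^sup>2" for t
  have d: "(\<psi> has_real_derivative
      (inner (g (x + t *\<^sub>R v)) v - inner (g x) v - L * t * (norm v)\<^sup>2)) (at t)" for t
  proof -
    have 1: "(f has_derivative (\<lambda>k. inner k (g (x + t *\<^sub>R v)))) (at (x + t *\<^sub>R v))"
      using grad by (simp add: gderiv_def)
    have "((\<lambda>t. f (x + t *\<^sub>R v)) has_derivative (\<lambda>k. inner (k *\<^sub>R v) (g (x + t *\<^sub>R v)))) (at t)"
      by (rule has_derivative_compose[where f = "\<lambda>t. x + t *\<^sub>R v" and g = f, OF _ 1]) (auto intro!: derivative_eq_intros)
    then have "((\<lambda>t. f (x + t *\<^sub>R v)) has_real_derivative inner (g (x + t *\<^sub>R v)) v) (at t)"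
      by (simp add: has_field_derivative_def inner_commute mult.commute[of _ "inner _ _"])
    then show ?thesis
      unfolding \<psi>_def by (auto intro!: derivative_eq_intros)
  qed
  have "\<psi> 1 \<le> \<psi> 0"
  proof (rule DERIV_nonpos_imp_nonincreasing[where f = \<psi>])
    fix t :: real assume t: "0 \<le> t" "t \<le> 1"
    have "inner (g (x + t *\<^sub>R v)) v - inner (g x) v \<le> norm (g (x + t *\<^sub>R v) - g x) * norm v"
      by (metis inner_diff_left norm_cauchy_schwarz)
    also have "\<dots> \<le> (L * norm (t *\<^sub>R v)) * norm v"
      using lip[of "x + t *\<^sub>R v" x] by (intro mult_right_mono) auto
    also have "\<dots> = L * t * (norm v)\<^sup>2"
      using t by (simp add: power2_eq_square)
    finally show "\<exists>y. (\<psi> has_real_derivative y) (at t) \<and> y \<le> 0"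
      using d by force
  qed simp
  then show ?thesis
    by (simp add: \<psi>_def)
qed

text \<open>The descent lemma for \<open>- f\<close> bounds \<open>f\<close> from below on the
  segment, and the chord bounds it from above. Dividing by \<open>\<tau>\<close> and letting it tend
  to 0 leaves the tangent inequality.\<close>

lemma convex_gradient_le:
  fixes f :: "'a::real_inner \<Rightarrow> real"
  assumes cvx: "convex_on UNIV f"
    and grad: "\<And>y. GDERIV f y :> g y"
    and lip: "\<And>y z. norm (g y - g z) \<le> L * norm (y - z)"
  shows "f x + inner (g x) (z - x) \<le> f z"
proof (rule le_of_le_add_small)
  fix \<tau> :: real assume \<tau>: "0 < \<tau>" "\<tau> \<le> 1"
  have "- f (x + \<tau> *\<^sub>R (z - x)) \<le>
      - f x + inner (- g x) (\<tau> *\<^sub>R (z - x)) + L / 2 * (norm (\<tau> *\<^sub>R (z - x)))\<^sup>2"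
  proof (rule descent_lemma[of "\<lambda>y. - f y" "\<lambda>y. - g y"])
    show "GDERIV (\<lambda>y. - f y) y :> - g y" for y
      using grad by (simp add: GDERIV_minus)
    show "norm (- g y - - g z) \<le> L * norm (y - z)" for y z
      using lip[of y z] by (simp add: norm_minus_commute)
  qed
  moreover have "f (x + \<tau> *\<^sub>R (z - x)) \<le> (1 - \<tau>) * f x + \<tau> * f z"
    using convex_onD[OF cvx, of \<tau> x z] \<tau> by (simp add: algebra_simps)
  ultimately have "\<tau> * f x + \<tau> * inner (g x) (z - x) \<le> \<tau> * f z + L / 2 * (\<tau> * norm (z - x))\<^sup>2"
    using \<tau> by (simp add: left_diff_distrib)
  then have "\<tau> * (f x + inner (g x) (z - x)) \<le> \<tau> * (f z + \<tau> * (L / 2 * (norm (z - x))\<^sup>2))"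
    by (simp add: distrib_left power2_eq_square mult_ac)
  then show "f x + inner (g x) (z - x) \<le> f z + \<tau> * (L / 2 * (norm (z - x))\<^sup>2)"
    using \<tau>(1) by simp
qed

text \<open>Closed sublevel sets express lower semicontinuity. Finitely many of the sets
  \<open>{y \<in> D. g y \<le> g z}\<close> share the best of the finitely many points
  \<open>z\<close>, so by compactness all of them share a point, and such a point is a
  minimizer.\<close>

lemma attains_min:
  fixes g :: "'a::heine_borel \<Rightarrow> real"
  assumes cl: "\<And>s. closed {y \<in> D. g y \<le> s}"
    and y0: "y0 \<in> D" and bd: "bounded {y \<in> D. g y \<le> g y0}"
  shows "\<exists>y\<in>D. \<forall>z\<in>D. g y \<le> g z"
proof -
  let ?S = "\<lambda>s. {y \<in> D. g y \<le> s}"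
  have "?S (g y0) \<inter> (\<Inter>z\<in>D. ?S (g z)) \<noteq> {}"
  proof (rule compact_imp_fip_image)
    show "compact (?S (g y0))"
      using cl bd compact_eq_bounded_closed by blast
    show "closed (?S (g z))" if "z \<in> D" for z
      using cl .
    fix I assume I: "finite I" "I \<subseteq> D"
    obtain m where m: "m \<in> insert y0 I" "\<And>z. z \<in> insert y0 I \<Longrightarrow> g m \<le> g z"
      using I(1) by (metis arg_min_if_finite(1) arg_min_least finite_insert insert_not_empty)
    then have "m \<in> ?S (g y0) \<inter> (\<Inter>z\<in>I. ?S (g z))"
      using I y0 by auto
    then show "?S (g y0) \<inter> (\<Inter>z\<in>I. ?S (g z)) \<noteq> {}"
      by blast
  qed
  then show ?thesis
    by blast
qed

text \<open>The set is the preimage of the closed epigraph under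
  \<open>y \<mapsto> (y, s - \<psi> y)\<close>. This is how closedness of \<open>R\<close> supplies
  the hypothesis of \<open>attains_min\<close>.\<close>

lemma closed_sublevel:
  assumes "proper_closed_convex D R" and "continuous_on UNIV \<psi>"
  shows "closed {y \<in> D. R y + \<psi> y \<le> s}"
proof -
  have "closed ((\<lambda>y. (y, s - \<psi> y)) -` epigraph_on D R)"
    using assms by (intro closed_vimage) (auto simp: proper_closed_convex_def intro!: continuous_intros)
  also have "(\<lambda>y. (y, s - \<psi> y)) -` epigraph_on D R = {y \<in> D. R y + \<psi> y \<le> s}"
    by (auto simp: epigraph_on_def)
  finally show ?thesis .
qed

text \<open>Fermat's rule, by comparing \<open>y\<close> with points at distance of order
  \<open>\<tau>\<close> on the segment to \<open>z\<close>. The term \<open>\<psi>\<close> enters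
  through a quadratic upper model at \<open>y\<close> with slope \<open>w\<close>; a squared
  distance has one, and by the descent lemma so has a smooth function.\<close>

lemma minimizer_subgradient:
  assumes cvx: "convex_on D R" and y: "y \<in> D"
    and min: "\<And>z. z \<in> D \<Longrightarrow> R y + \<psi> y \<le> R z + \<psi> z"
    and \<psi>: "\<And>v. \<psi> (y + v) \<le> \<psi> y + inner w v + K * (norm v)\<^sup>2"
  shows "- w \<in> subdiff D R y"
proof -
  have "R y + inner (- w) (z - y) \<le> R z" if z: "z \<in> D" for z
  proof (rule le_of_le_add_small)
    fix \<tau> :: real assume \<tau>: "0 < \<tau>" "\<tau> \<le> 1"
    define z' where "z' = y + \<tau> *\<^sub>R (z - y)"
    have z'_eq: "z' = (1 - \<tau>) *\<^sub>R y + \<tau> *\<^sub>R z"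
      by (simp add: z'_def algebra_simps)
    have z'D: "z' \<in> D"
      using convexD_alt[OF convex_on_imp_convex[OF cvx] y z, of \<tau>] \<tau> by (simp add: z'_eq)
    have "R z' \<le> (1 - \<tau>) * R y + \<tau> * R z"
      using convex_onD[OF cvx, of \<tau> y z] \<tau> y z by (simp add: z'_eq)
    moreover have "\<psi> z' \<le> \<psi> y + inner w (\<tau> *\<^sub>R (z - y)) + K * (norm (\<tau> *\<^sub>R (z - y)))\<^sup>2"
      unfolding z'_def by (rule \<psi>)
    ultimately have "\<tau> * R y - \<tau> * inner w (z - y) \<le> \<tau> * R z + K * (\<tau> * norm (z - y))\<^sup>2"
      using min[OF z'D] \<tau> by (simp add: left_diff_distrib)
    then have "\<tau> * (R y + inner (- w) (z - y)) \<le> \<tau> * (R z + \<tau> * (K * (norm (z - y))\<^sup>2))"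
      by (simp add: right_diff_distrib distrib_left power2_eq_square mult_ac)
    then show "R y + inner (- w) (z - y) \<le> R z + \<tau> * (K * (norm (z - y))\<^sup>2)"
      using \<tau>(1) by simp
  qed
  then show ?thesis
    using y by (simp add: subdiff_def)
qed

text \<open>\<open>R\<close> falls at most linearly, so the quadratic term of the proximal problem
  dominates it. Inside the unit ball around \<open>y0\<close> a minimum exists by compactness;
  outside, convexity extends the bound along rays from \<open>y0\<close>.\<close>

lemma proper_closed_convex_lower_bound:
  assumes R: "proper_closed_convex D R" and y0: "y0 \<in> D"
  shows "\<exists>k\<ge>0. \<forall>y\<in>D. R y0 - k * (1 + norm (y - y0)) \<le> R y"
proof -
  have "\<exists>w\<in>D \<inter> cball y0 1. \<forall>z\<in>D \<inter> cball y0 1. R w \<le> R z"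
  proof (rule attains_min)
    have eq: "{y \<in> D \<inter> cball y0 1. R y \<le> s} = {y \<in> D. R y + 0 \<le> s} \<inter> cball y0 1" for s
      by auto
    show "closed {y \<in> D \<inter> cball y0 1. R y \<le> s}" for s
      unfolding eq using R by (intro closed_Int closed_sublevel) auto
    show "y0 \<in> D \<inter> cball y0 1"
      using y0 by simp
    show "bounded {y \<in> D \<inter> cball y0 1. R y \<le> R y0}"
      by (rule bounded_subset[OF bounded_cball]) auto
  qed
  then obtain w where w: "w \<in> D" "\<And>z. z \<in> D \<Longrightarrow> norm (z - y0) \<le> 1 \<Longrightarrow> R w \<le> R z"
    by (auto simp: dist_norm norm_minus_commute)
  define k where "k = R y0 - R w"
  have k: "k \<ge> 0"
    using w(2)[OF y0] by (simp add: k_def)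
  have "R y0 - k * (1 + norm (y - y0)) \<le> R y" if y: "y \<in> D" for y
  proof (cases "norm (y - y0) \<le> 1")
    case True
    have "R y0 - k \<le> R y"
      using w(2)[OF y True] by (simp add: k_def)
    moreover have "0 \<le> k * norm (y - y0)"
      using k by simp
    ultimately show ?thesis
      by (simp add: algebra_simps)
  next
    case False
    define d where "d = norm (y - y0)"
    have d: "d > 1"
      using False by (simp add: d_def)
    \<comment> \<open>The point where the segment from \<open>y0\<close> to \<open>y\<close> leaves
      the unit ball.\<close>
    define z where "z = (1 - 1 / d) *\<^sub>R y0 + (1 / d) *\<^sub>R y"
    have cvx: "convex_on D R"
      using R by (simp add: proper_closed_convex_def)
    have "z \<in> D"
      using convexD_alt[OF convex_on_imp_convex[OF cvx] y0 y, of "1 / d"] d by (simp add: z_def)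
    moreover have "z - y0 = (1 / d) *\<^sub>R (y - y0)"
      by (simp add: z_def algebra_simps)
    then have "norm (z - y0) \<le> 1"
      using d by (simp add: d_def)
    ultimately have "R w \<le> R z"
      using w(2) by blast
    also have "R z \<le> (1 - 1 / d) * R y0 + (1 / d) * R y"
      using convex_onD[OF cvx, of "1 / d" y0 y] d y0 y by (simp add: z_def)
    finally have "d * R w \<le> d * ((1 - 1 / d) * R y0 + (1 / d) * R y)"
      using d by simp
    also have "\<dots> = (d - 1) * R y0 + R y"
      using d by (simp add: field_simps)
    finally have "R y0 - k * d \<le> R y"
      by (simp add: k_def algebra_simps)
    then show ?thesis
      using k by (simp add: d_def algebra_simps)
  qed
  then show ?thesis
    using k by blast
qed

lemma prox_minimizer_exists:
  fixes D :: "'a::euclidean_space set"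
  assumes R: "proper_closed_convex D R" and \<gamma>: "\<gamma> > 0"
  shows "\<exists>y\<in>D. \<forall>z\<in>D. \<gamma> * R y + (1/2) * (norm (x - y))\<^sup>2 \<le> \<gamma> * R z + (1/2) * (norm (x - z))\<^sup>2"
proof -
  obtain y0 where y0: "y0 \<in> D"
    using R by (auto simp: proper_closed_convex_def)
  obtain k where k: "k \<ge> 0" "\<And>y. y \<in> D \<Longrightarrow> R y0 - k * (1 + norm (y - y0)) \<le> R y"
    using proper_closed_convex_lower_bound[OF R y0] by blast
  let ?g = "\<lambda>y. \<gamma> * R y + (1/2) * (norm (x - y))\<^sup>2"
  \<comment> \<open>With \<open>N = norm (x - y)\<close>, comparison of \<open>y\<close> with
    \<open>y0\<close> gives \<open>N\<^sup>2 \<le> A + 2 * \<gamma> * k * N\<close>;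
    \<open>A\<close> collects the terms free of \<open>N\<close>. This inequality bounds the
    sublevel set.\<close>
  define A where "A = (norm (x - y0))\<^sup>2 + 2 * \<gamma> * k * (1 + norm (x - y0))"
  have A: "A \<ge> 0"
    using \<gamma> k by (simp add: A_def)
  show ?thesis
  proof (rule attains_min)
    fix s
    have "?g y = \<gamma> * (R y + (norm (x - y))\<^sup>2 / (2 * \<gamma>))" for y
      using \<gamma> by (simp add: field_simps)
    then have "{y \<in> D. ?g y \<le> s} = {y \<in> D. R y + (norm (x - y))\<^sup>2 / (2 * \<gamma>) \<le> s / \<gamma>}"
      using \<gamma> by (simp only: pos_le_divide_eq mult.commute[of \<gamma>])
    then show "closed {y \<in> D. ?g y \<le> s}"
      using R \<gamma> by (auto intro!: closed_sublevel continuous_intros)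
  next
    have "norm (x - y) \<le> 2 * \<gamma> * k + A + 1" if y: "y \<in> D" "?g y \<le> ?g y0" for y
    proof (rule ccontr)
      define N where "N = norm (x - y)"
      assume "\<not> norm (x - y) \<le> 2 * \<gamma> * k + A + 1"
      then have N: "N > 2 * \<gamma> * k + A + 1"
        by (simp add: N_def)
      moreover have "2 * \<gamma> * k \<ge> 0"
        using \<gamma> k by simp
      ultimately have N1: "N > 1"
        using A by linarith
      have "norm (y - y0) \<le> N + norm (x - y0)"
        unfolding N_def by norm
      then have "\<gamma> * (k * (1 + norm (y - y0))) \<le> \<gamma> * (k * (1 + (N + norm (x - y0))))"
        using \<gamma> k by (intro mult_left_mono) auto
      moreover have "\<gamma> * (R y0 - k * (1 + norm (y - y0))) \<le> \<gamma> * R y"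
        using k(2)[OF y(1)] \<gamma> by (intro mult_left_mono) auto
      ultimately have "N\<^sup>2 \<le> A + 2 * \<gamma> * k * N"
        using y(2) by (simp add: A_def N_def algebra_simps)
      moreover have "(2 * \<gamma> * k + A + 1) * N \<le> N\<^sup>2"
        using N N1 by (simp add: power2_eq_square)
      moreover have "A * 1 \<le> A * N"
        using A N1 by (intro mult_left_mono) auto
      ultimately show False
        using N1 by (simp add: algebra_simps)
    qed
    then have "{y \<in> D. ?g y \<le> ?g y0} \<subseteq> cball x (2 * \<gamma> * k + A + 1)"
      by (auto simp: dist_norm)
    then show "bounded {y \<in> D. ?g y \<le> ?g y0}"
      using bounded_cball bounded_subset by blast
  qed (rule y0)
qed

lemma subdiff_of_prox_minimizer:
  assumes R: "proper_closed_convex D R" and \<gamma>: "\<gamma> > 0" and y: "y \<in> D"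
    and min: "\<And>z. z \<in> D \<Longrightarrow> \<gamma> * R y + (1/2) * (norm (x - y))\<^sup>2 \<le> \<gamma> * R z + (1/2) * (norm (x - z))\<^sup>2"
  shows "(1 / \<gamma>) *\<^sub>R (x - y) \<in> subdiff D R y"
proof -
  let ?\<psi> = "\<lambda>y. (norm (x - y))\<^sup>2 / (2 * \<gamma>)"
  have "- ((1 / \<gamma>) *\<^sub>R (y - x)) \<in> subdiff D R y"
  proof (rule minimizer_subgradient)
    show "convex_on D R"
      using R by (simp add: proper_closed_convex_def)
    have "\<gamma> * R z + (1/2) * (norm (x - z))\<^sup>2 = \<gamma> * (R z + ?\<psi> z)" for z
      using \<gamma> by (simp add: field_simps)
    then show "R y + ?\<psi> y \<le> R z + ?\<psi> z" if "z \<in> D" for z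
      using min[OF that] \<gamma> by simp
    show "?\<psi> (y + v) \<le> ?\<psi> y + inner ((1 / \<gamma>) *\<^sub>R (y - x)) v + 1 / (2 * \<gamma>) * (norm v)\<^sup>2" for v
      using \<gamma> by (simp add: power2_norm_eq_inner algebra_simps inner_commute divide_simps)
  qed (rule y)
  then show ?thesis
    by (simp add: scaleR_minus_right[symmetric] del: scaleR_minus_right)
qed

lemma subdiff_monotone:
  assumes "u \<in> subdiff D R y" and "v \<in> subdiff D R z"
  shows "inner (u - v) (y - z) \<ge> 0"
proof -
  have "y \<in> D" "z \<in> D"
    using assms by (auto simp: subdiff_def split: if_splits)
  then have "R z \<ge> R y + inner u (z - y)" "R y \<ge> R z + inner v (y - z)"
    using assms by (auto simp: subdiff_def)
  then show ?thesis
    by (simp add: algebra_simps)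
qed

text \<open>Monotonicity of the subdifferential gives firm nonexpansiveness of the resolvent, and
  Cauchy-Schwarz weakens it to this form. The case \<open>x = x'\<close> gives uniqueness of the
  proximal point, the general case continuity of \<open>prox\<close>.\<close>

lemma subdiff_step_nonexpansive:
  assumes \<gamma>: "\<gamma> > 0"
    and y: "(1 / \<gamma>) *\<^sub>R (x - y) \<in> subdiff D R y"
    and y': "(1 / \<gamma>) *\<^sub>R (x' - y') \<in> subdiff D R y'"
  shows "norm (y - y') \<le> norm (x - x')"
proof -
  have "0 \<le> inner ((1 / \<gamma>) *\<^sub>R (x - y) - (1 / \<gamma>) *\<^sub>R (x' - y')) (y - y')"
    by (rule subdiff_monotone[OF y y'])
  also have "\<dots> = (1 / \<gamma>) * inner ((x - x') - (y - y')) (y - y')"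
    by (simp add: algebra_simps)
  finally have "inner (y - y') (y - y') \<le> inner (x - x') (y - y')"
    using \<gamma> by (simp add: zero_le_divide_iff inner_diff_left)
  also have "\<dots> \<le> norm (x - x') * norm (y - y')"
    by (rule norm_cauchy_schwarz)
  finally have "norm (y - y') * norm (y - y') \<le> norm (x - x') * norm (y - y')"
    by (simp add: dot_square_norm power2_eq_square)
  then show ?thesis
    by (cases "y = y'") auto
qed

text \<open>The definite description in \<open>prox\<close> denotes a minimizer once there is
  exactly one: existence comes from coercivity, uniqueness from nonexpansiveness.\<close>

lemma prox_props:
  fixes D :: "'a::euclidean_space set"
  assumes R: "proper_closed_convex D R" and \<gamma>: "\<gamma> > 0"
  shows prox_in_domain: "prox \<gamma> D R x \<in> D"
    and prox_subgradient: "(1 / \<gamma>) *\<^sub>R (x - prox \<gamma> D R x) \<in> subdiff D R (prox \<gamma> D R x)"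
proof -
  let ?P = "\<lambda>y. y \<in> D \<and>
     (\<forall>z\<in>D. \<gamma> * R y + (1/2) * (norm (x - y))\<^sup>2 \<le> \<gamma> * R z + (1/2) * (norm (x - z))\<^sup>2)"
  have sub: "(1 / \<gamma>) *\<^sub>R (x - y) \<in> subdiff D R y" if "?P y" for y
    using that by (intro subdiff_of_prox_minimizer[OF R \<gamma>]) auto
  have "\<exists>!y. ?P y"
  proof (rule ex_ex1I)
    show "\<exists>y. ?P y"
      using prox_minimizer_exists[OF R \<gamma>, of x] by blast
    show "y = y'" if "?P y" "?P y'" for y y'
      using subdiff_step_nonexpansive[OF \<gamma> sub[OF that(1)] sub[OF that(2)]] by simp
  qed
  then have "?P (prox \<gamma> D R x)"
    unfolding prox_def by (rule theI')
  then show "prox \<gamma> D R x \<in> D" "(1 / \<gamma>) *\<^sub>R (x - prox \<gamma> D R x) \<in> subdiff D R (prox \<gamma> D R x)"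
    using sub by auto
qed

lemma lipschitz_imp_continuous_on:
  fixes g :: "'a::real_normed_vector \<Rightarrow> 'b::real_normed_vector"
  assumes "\<And>x y. norm (g x - g y) \<le> L * norm (x - y)"
  shows "continuous_on UNIV g"
proof (rule lipschitz_on_continuous_on)
  \<comment> \<open>\<open>lipschitz_on\<close> asks for a nonnegative constant, while the sign of
    \<open>L\<close> is not known here.\<close>
  have "norm (g x - g y) \<le> max L 0 * norm (x - y)" for x y
    using assms[of x y] mult_right_mono[of L "max L 0" "norm (x - y)"] by simp
  then show "(max L 0)-lipschitz_on UNIV g"
    by (intro lipschitz_onI) (auto simp: dist_norm)
qed

lemma continuous_on_prox:
  fixes D :: "'a::euclidean_space set"
  assumes "proper_closed_convex D R" and "\<gamma> > 0"
  shows "continuous_on UNIV (prox \<gamma> D R)"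
  using subdiff_step_nonexpansive[OF assms(2) prox_subgradient[OF assms] prox_subgradient[OF assms]]
  by (intro lipschitz_imp_continuous_on[where L = 1]) simp

text \<open>\<open>R\<close> is lower semicontinuous on \<open>D\<close>, so its sublevel sets
  within \<open>D\<close> are closed. Values of \<open>R\<close> off \<open>D\<close> are arbitrary,
  hence the condition that \<open>x\<close> stays in \<open>D\<close>.\<close>

lemma borel_measurable_closed_convex_compose:
  fixes D :: "'a::euclidean_space set"
  assumes R: "proper_closed_convex D R" and x: "x \<in> borel_measurable N"
    and D: "\<And>s. s \<in> space N \<Longrightarrow> x s \<in> D"
  shows "(\<lambda>s. R (x s)) \<in> borel_measurable N"
proof (rule borel_measurable_iff_le[THEN iffD2, rule_format])
  fix a
  have "{w \<in> space N. R (x w) \<le> a} = x -` {y \<in> D. R y + 0 \<le> a} \<inter> space N"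
    using D by auto
  moreover have "{y \<in> D. R y + 0 \<le> a} \<in> sets borel"
    using R by (intro borel_closed closed_sublevel) auto
  ultimately show "{w \<in> space N. R (x w) \<le> a} \<in> sets N"
    using measurable_sets[OF x] by presburger
qed

subsection \<open>One inexact proximal gradient step under the KL inequality\<close>

locale KL_composite =
  fixes f :: "'a::euclidean_space \<Rightarrow> real" and g :: "'a \<Rightarrow> 'a" and L :: real
    and D :: "'a set" and R :: "'a \<Rightarrow> real" and xstar :: 'a and \<mu> :: real
  assumes f_convex: "convex_on UNIV f"
    and f_grad: "\<And>y. GDERIV f y :> g y"
    and g_lip: "\<And>y z. norm (g y - g z) \<le> L * norm (y - z)"
    and R_pcc: "proper_closed_convex D R"
    and xstar_min: "\<And>y. y \<in> D \<Longrightarrow> f xstar + R xstar \<le> f y + R y"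
    and mu_pos: "\<mu> > 0"
    and KL: "\<And>y u. y \<in> D \<Longrightarrow> u \<in> subdiff D R y \<Longrightarrow>
               (norm (g y + u))\<^sup>2 \<ge> 2 * \<mu> * (f y + R y - f xstar - R xstar)"
begin

definition gap :: "'a \<Rightarrow> real" where
  "gap y = f y + R y - f xstar - R xstar"

lemma gap_nonneg: "y \<in> D \<Longrightarrow> 0 \<le> gap y"
  using xstar_min[of y] by (simp add: gap_def)

lemma continuous_on_f: "continuous_on UNIV f"
  using f_grad unfolding gderiv_def
  by (intro continuous_at_imp_continuous_on ballI has_derivative_continuous)

text \<open>\<open>z\<close> is the proximal point of \<open>x\<close> for the whole objective
  \<open>f + R\<close>, and \<open>q\<close> is the subgradient of \<open>gap\<close> at
  \<open>z\<close> that it provides. With \<open>u = q - g z\<close> the vector in the KL inequality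
  is exactly \<open>q\<close>.\<close>

lemma proximal_point:
  assumes \<gamma>: "\<gamma> > 0" and x: "x \<in> D"
  shows "\<exists>z\<in>D. \<exists>q. x = z + \<gamma> *\<^sub>R q \<and> (\<forall>w\<in>D. gap z + inner q (w - z) \<le> gap w)
    \<and> 2 * \<mu> * gap z \<le> (norm q)\<^sup>2"
proof -
  let ?\<psi> = "\<lambda>y. f y + (norm (x - y))\<^sup>2 / (2 * \<gamma>)"
  have "\<exists>z\<in>D. \<forall>w\<in>D. R z + ?\<psi> z \<le> R w + ?\<psi> w"
  proof (rule attains_min)
    show "closed {y \<in> D. R y + ?\<psi> y \<le> s}" for s
      by (rule closed_sublevel[OF R_pcc])
        (use \<gamma> in \<open>auto intro!: continuous_intros continuous_on_f\<close>)
    show "x \<in> D" by (rule x)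
    \<comment> \<open>Since \<open>gap y\<close> is nonnegative, a point that does no worse than
      \<open>x\<close> has its quadratic term bounded by \<open>gap x\<close>.\<close>
    have "norm (x - y) \<le> sqrt (2 * \<gamma> * gap x)" if "y \<in> D" "R y + ?\<psi> y \<le> R x + ?\<psi> x" for y
    proof (rule real_le_rsqrt)
      have "(norm (x - y))\<^sup>2 / (2 * \<gamma>) \<le> gap x"
        using that xstar_min[of y] by (simp add: gap_def)
      then show "(norm (x - y))\<^sup>2 \<le> 2 * \<gamma> * gap x"
        using \<gamma> by (simp add: field_simps)
    qed
    then have "{y \<in> D. R y + ?\<psi> y \<le> R x + ?\<psi> x} \<subseteq> cball x (sqrt (2 * \<gamma> * gap x))"
      by (auto simp: dist_norm)
    then show "bounded {y \<in> D. R y + ?\<psi> y \<le> R x + ?\<psi> x}"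
      using bounded_cball bounded_subset by blast
  qed
  then obtain z where z: "z \<in> D" "\<And>w. w \<in> D \<Longrightarrow> R z + ?\<psi> z \<le> R w + ?\<psi> w"
    by blast
  define q where "q = (1 / \<gamma>) *\<^sub>R (x - z)"
  \<comment> \<open>The slope of the smooth part at \<open>z\<close> is \<open>g z - q\<close>; its
    quadratic model adds the term of the descent lemma to the exact one of the squared
    distance.\<close>
  have "- (g z - q) \<in> subdiff D R z"
  proof (rule minimizer_subgradient)
    show "convex_on D R"
      using R_pcc by (simp add: proper_closed_convex_def)
    show "?\<psi> (z + v) \<le> ?\<psi> z + inner (g z - q) v + (L / 2 + 1 / (2 * \<gamma>)) * (norm v)\<^sup>2" for v
    proof -
      have "(norm (x - (z + v)))\<^sup>2 / (2 * \<gamma>)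
          = (norm (x - z))\<^sup>2 / (2 * \<gamma>) - inner q v + 1 / (2 * \<gamma>) * (norm v)\<^sup>2"
        using \<gamma> by (simp add: q_def power2_norm_eq_inner algebra_simps inner_commute divide_simps)
      then show ?thesis
        using descent_lemma[OF f_grad g_lip, of z v] by (simp add: inner_diff_left distrib_right)
    qed
  qed (use z in auto)
  then have u: "q - g z \<in> subdiff D R z"
    by simp
  show ?thesis
  proof (intro bexI exI conjI ballI)
    show "z \<in> D" by fact
    show "x = z + \<gamma> *\<^sub>R q"
      using \<gamma> by (simp add: q_def)
    show "gap z + inner q (w - z) \<le> gap w" if "w \<in> D" for w
    proof -
      have "R z + inner (q - g z) (w - z) \<le> R w"
        using u that by (simp add: subdiff_def split: if_splits)
      then show ?thesis
        using convex_gradient_le[OF f_convex f_grad g_lip, of z w]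
        by (simp add: gap_def inner_diff_left)
    qed
    show "2 * \<mu> * gap z \<le> (norm q)\<^sup>2"
      using KL[OF z(1) u] by (simp add: gap_def)
  qed
qed

text \<open>The KL inequality is used at the two proximal points of \<open>x\<close> with step sizes \<open>\<gamma>\<close> and
  \<open>\<gamma> / 2\<close>, which gives the factor \<open>(2 + m) / (2 + 3 * m)\<close> with \<open>m = \<gamma> * \<mu>\<close>. A single proximal
  point gives \<open>(1 + m) / (1 + 2 * m)\<close>, which is too weak for \<open>m > 1\<close>.\<close>

lemma envelope_le:
  assumes \<gamma>: "\<gamma> > 0" and x: "x \<in> D"
    and \<rho>: "1 / (1 + \<gamma> * \<mu> / 2) \<le> \<rho>" "1 / 2 \<le> \<rho>"
  obtains z where "z \<in> D" "gap z + (norm (x - z))\<^sup>2 / (2 * \<gamma>) \<le> \<rho> * gap x"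
proof -
  define m where "m = \<gamma> * \<mu>"
  have m: "m > 0"
    using \<gamma> mu_pos by (simp add: m_def)
  obtain z q where z: "z \<in> D" "x = z + \<gamma> *\<^sub>R q"
      "\<forall>w\<in>D. gap z + inner q (w - z) \<le> gap w" "2 * \<mu> * gap z \<le> (norm q)\<^sup>2"
    using proximal_point[OF \<gamma> x] by (elim bexE exE conjE) (rule that)
  obtain z' q' where z': "z' \<in> D" "x = z' + (\<gamma> / 2) *\<^sub>R q'"
      "\<forall>w\<in>D. gap z' + inner q' (w - z') \<le> gap w" "2 * \<mu> * gap z' \<le> (norm q')\<^sup>2"
    using proximal_point[OF half_gt_zero[OF \<gamma>] x] by (elim bexE exE conjE) (rule that)
  define Q where "Q = \<gamma> * (norm q)\<^sup>2 / 4"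
  define Q' where "Q' = \<gamma> * (norm q')\<^sup>2 / 4"
  \<comment> \<open>\<open>E\<close> and \<open>E'\<close> are the Moreau envelopes of
    \<open>gap\<close> at \<open>x\<close> for the parameters \<open>\<gamma>\<close> and
    \<open>\<gamma> / 2\<close>, since \<open>x - z = \<gamma> *\<^sub>R q\<close> and
    \<open>x - z' = (\<gamma> / 2) *\<^sub>R q'\<close>.\<close>
  define E where "E = gap z + 2 * Q"
  define E' where "E' = gap z' + Q'"
  have xz: "x - z = \<gamma> *\<^sub>R q"
    using z(2) by simp
  have xz': "x - z' = (\<gamma> / 2) *\<^sub>R q'"
    using z'(2) by simp
  have "z' - z = (x - z) - (x - z')"
    by simp
  then have "z' - z = \<gamma> *\<^sub>R q - (\<gamma> / 2) *\<^sub>R q'"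
    unfolding xz xz' .
  then have "gap z + inner q (\<gamma> *\<^sub>R q - (\<gamma> / 2) *\<^sub>R q') \<le> gap z'"
    using bspec[OF z(3) z'(1)] by simp
  \<comment> \<open>Completing the square removes the mixed product of \<open>q\<close> and
    \<open>q'\<close> from the subgradient inequality at \<open>z\<close> tested at
    \<open>z'\<close>.\<close>
  moreover have "0 \<le> \<gamma> / 4 * (norm (q - q'))\<^sup>2"
    using \<gamma> by simp
  ultimately have E_step: "E + Q \<le> E'"
    by (simp add: E_def E'_def Q_def Q'_def power2_norm_eq_inner algebra_simps inner_commute)
  have "gap z' + inner q' (x - z') \<le> gap x"
    using bspec[OF z'(3) x] .
  then have E'_step: "E' + Q' \<le> gap x"
    unfolding xz' by (simp add: E'_def Q'_def power2_norm_eq_inner)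
  \<comment> \<open>KL bounds \<open>E\<close> by a multiple of \<open>Q\<close>, so the gain
    \<open>Q\<close> in \<open>E_step\<close> becomes the factor
    \<open>(2 + 3 * m) / (2 + 2 * m)\<close> on \<open>E\<close>. The same for \<open>E'\<close>
    gives \<open>(2 + 2 * m) / (2 + m)\<close>, and the product telescopes.\<close>
  have "m * gap z \<le> 2 * Q"
    using mult_left_mono[OF z(4), of \<gamma>] \<gamma> by (simp add: m_def Q_def)
  then have "m * E \<le> 2 * (1 + m) * Q"
    by (simp add: E_def algebra_simps)
  then have 1: "(2 + 3 * m) * E \<le> (2 + 2 * m) * E'"
    using mult_left_mono[OF E_step, of "2 + 2 * m"] m by (simp add: algebra_simps)
  have "m * gap z' \<le> 2 * Q'"
    using mult_left_mono[OF z'(4), of \<gamma>] \<gamma> by (simp add: m_def Q'_def)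
  then have "m * E' \<le> (2 + m) * Q'"
    by (simp add: E'_def algebra_simps)
  then have 2: "(2 + 2 * m) * E' \<le> (2 + m) * gap x"
    using mult_left_mono[OF E'_step, of "2 + m"] m by (simp add: algebra_simps)
  \<comment> \<open>\<open>(2 + m) / (2 + 3 * m)\<close> is at most \<open>2 / (2 + m)\<close> for
    \<open>m \<le> 2\<close> and at most \<open>1 / 2\<close> for \<open>m \<ge> 2\<close>, so each
    lower bound on \<open>\<rho>\<close> covers one range.\<close>
  have \<rho>': "(2 + m) \<le> \<rho> * (2 + 3 * m)"
  proof (cases "m \<le> 2")
    case True
    have "2 \<le> \<rho> * (2 + m)"
      using \<rho>(1) m by (simp add: m_def[symmetric] field_simps)
    then have "2 * (2 + 3 * m) \<le> \<rho> * (2 + m) * (2 + 3 * m)"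
      using m by (intro mult_right_mono) auto
    moreover have "m * m \<le> 2 * m"
      using True m by simp
    ultimately have "(2 + m) * (2 + m) \<le> (2 + m) * (\<rho> * (2 + 3 * m))"
      by (simp add: algebra_simps)
    then show ?thesis
      using m by simp
  next
    case False
    then have "(2 + m) \<le> 1 / 2 * (2 + 3 * m)"
      by simp
    also have "\<dots> \<le> \<rho> * (2 + 3 * m)"
      using \<rho>(2) m by (intro mult_right_mono) auto
    finally show ?thesis .
  qed
  have "(2 + 3 * m) * E \<le> (2 + m) * gap x"
    using 1 2 by simp
  also have "\<dots> \<le> \<rho> * (2 + 3 * m) * gap x"
    by (intro mult_right_mono \<rho>' gap_nonneg x)
  finally have "(2 + 3 * m) * E \<le> (2 + 3 * m) * (\<rho> * gap x)"
    by (simp add: mult_ac)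
  then have "E \<le> \<rho> * gap x"
    using m by simp
  moreover have "(norm (x - z))\<^sup>2 / (2 * \<gamma>) = 2 * Q"
    unfolding xz using \<gamma> by (simp add: Q_def power_mult_distrib power2_eq_square)
  ultimately show thesis
    using that[OF z(1)] by (simp add: E_def)
qed

text \<open>The comparison point is the \<open>z\<close> of \<open>envelope_le\<close>. Adding the
  three first-order inequalities leaves the products of \<open>p\<close> with
  \<open>\<Delta>\<close> and with \<open>v\<close>. The first cancels in the expansion
  \<open>e2\<close> of the squared error, the second is absorbed by the square \<open>sq\<close>;
  both use the same \<open>\<gamma> / 2 * (norm p)\<^sup>2\<close>.\<close>

lemma prox_step_le:
  assumes \<gamma>: "\<gamma> > 0" and x: "x \<in> D"
    and \<rho>: "1 / (1 + \<gamma> * \<mu> / 2) \<le> \<rho>" "1 / 2 \<le> \<rho>"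
    and b: "0 \<le> b" "2 * (\<gamma> * L) + b \<le> 1" and L: "0 \<le> L"
    and y_def: "y = prox \<gamma> D R (x - \<gamma> *\<^sub>R d)"
  shows "gap y + b\<^sup>2 / (2 * \<gamma>) * (norm (y - x))\<^sup>2 \<le> \<rho> * gap x + \<gamma> / 2 * (norm (d - g x))\<^sup>2"
proof -
  obtain z where z: "z \<in> D" "gap z + (norm (x - z))\<^sup>2 / (2 * \<gamma>) \<le> \<rho> * gap x"
    using envelope_le[OF \<gamma> x \<rho>] by blast
  define u where "u = (1 / \<gamma>) *\<^sub>R (x - \<gamma> *\<^sub>R d - y)"
  have u: "u \<in> subdiff D R y"
    unfolding u_def y_def by (rule prox_subgradient[OF R_pcc \<gamma>])
  define p where "p = g x + u"
  define v where "v = z - x"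
  define \<Delta> where "\<Delta> = y - x"
  have xd: "y = x + \<Delta>" "z = x + v"
    by (simp_all add: \<Delta>_def v_def)
  have "d = - u - (1 / \<gamma>) *\<^sub>R \<Delta>"
    using \<gamma> by (simp add: u_def \<Delta>_def algebra_simps)
  then have e: "d - g x = - p - (1 / \<gamma>) *\<^sub>R \<Delta>"
    by (simp add: p_def)
  have R: "R y + inner u (v - \<Delta>) \<le> R z"
    using u z(1) by (auto simp: subdiff_def xd algebra_simps split: if_splits dest!: bspec[of D _ z])
  have fy: "f y \<le> f x + inner (g x) \<Delta> + L / 2 * (norm \<Delta>)\<^sup>2"
    unfolding xd by (rule descent_lemma[OF f_grad g_lip])
  have fz: "f x + inner (g x) v \<le> f z"
    using convex_gradient_le[OF f_convex f_grad g_lip, of x z] by (simp add: v_def)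
  have "0 \<le> (norm (\<gamma> *\<^sub>R p + v))\<^sup>2 / (2 * \<gamma>)"
    using \<gamma> by simp
  then have sq: "0 \<le> \<gamma> / 2 * (norm p)\<^sup>2 + inner p v + (norm v)\<^sup>2 / (2 * \<gamma>)"
    using \<gamma> by (simp add: power2_norm_eq_inner algebra_simps inner_commute add_divide_distrib)
  have e2: "\<gamma> / 2 * (norm (d - g x))\<^sup>2
      = \<gamma> / 2 * (norm p)\<^sup>2 + inner p \<Delta> + (norm \<Delta>)\<^sup>2 / (2 * \<gamma>)"
    unfolding e using \<gamma>
    by (simp add: power2_norm_eq_inner algebra_simps inner_commute add_divide_distrib)
  \<comment> \<open>With \<open>a = \<gamma> * L \<le> 1 / 2\<close> and
    \<open>b \<le> 1 - 2 * a\<close>, the left side is at most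
    \<open>1 - 3 * a + 4 * a\<^sup>2\<close>, which is at most \<open>1 - a\<close>. It lets the
    term \<open>(norm \<Delta>)\<^sup>2 / (2 * \<gamma>)\<close> pay for both the smoothness error
    and the kept displacement.\<close>
  have "\<gamma> * L + b\<^sup>2 \<le> 1"
  proof -
    define a where "a = \<gamma> * L"
    have a: "a \<ge> 0" "b \<le> 1 - 2 * a" "a \<le> 1 / 2"
      using \<gamma> L b by (auto simp: a_def)
    have "b\<^sup>2 \<le> (1 - 2 * a)\<^sup>2"
      using a b by (intro power_mono) auto
    moreover have "a * a \<le> a * (1 / 2)"
      using a by (intro mult_left_mono) auto
    ultimately have "a + b\<^sup>2 \<le> 1"
      using a by (simp add: power2_eq_square algebra_simps)
    then show ?thesis
      by (simp add: a_def)
  qed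
  then have "(\<gamma> * L + b\<^sup>2) * ((norm \<Delta>)\<^sup>2 / (2 * \<gamma>)) \<le> 1 * ((norm \<Delta>)\<^sup>2 / (2 * \<gamma>))"
    using \<gamma> by (intro mult_right_mono) auto
  then have step: "L / 2 * (norm \<Delta>)\<^sup>2 + b\<^sup>2 / (2 * \<gamma>) * (norm \<Delta>)\<^sup>2 \<le> (norm \<Delta>)\<^sup>2 / (2 * \<gamma>)"
    using \<gamma> by (simp add: add_divide_distrib distrib_right)
  have nv: "norm (x - z) = norm v"
    by (simp add: v_def norm_minus_commute)
  have "gap y + b\<^sup>2 / (2 * \<gamma>) * (norm \<Delta>)\<^sup>2
      \<le> gap z + (norm v)\<^sup>2 / (2 * \<gamma>) + \<gamma> / 2 * (norm (d - g x))\<^sup>2"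
    using R fy fz sq step unfolding e2 gap_def p_def inner_add_left inner_diff_right by linarith
  then show ?thesis
    using z(2) by (simp add: \<Delta>_def[symmetric] nv)
qed

end

subsection \<open>Independence and compression errors\<close>

text \<open>The sigma-algebra generated by the \<open>\<xi> k\<close> with \<open>k \<in> A\<close>,
  encoded as a measurable space on the sample points, so that dependence on the past becomes plain
  measurability of functions of \<open>s\<close>.\<close>

definition history :: "'m measure \<Rightarrow> 'w measure \<Rightarrow> (nat \<Rightarrow> 'm \<Rightarrow> 'w) \<Rightarrow> nat set \<Rightarrow> 'm measure" where
  "history M W \<xi> A = vimage_algebra (space M) (\<lambda>s. \<lambda>k\<in>A. \<xi> k s) (PiM A (\<lambda>_. W))"

lemma space_history [simp]: "space (history M W \<xi> A) = space M"
  by (simp add: history_def)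

context
  fixes M :: "'m measure" and W :: "'w measure" and \<xi> :: "nat \<Rightarrow> 'm \<Rightarrow> 'w"
  assumes \<xi>_meas: "\<And>k. \<xi> k \<in> measurable M W"
begin

lemma measurable_history_component:
  assumes "k \<in> A"
  shows "\<xi> k \<in> measurable (history M W \<xi> A) W"
proof -
  have "(\<lambda>s. \<lambda>k\<in>A. \<xi> k s) \<in> measurable (history M W \<xi> A) (PiM A (\<lambda>_. W))"
    unfolding history_def using measurable_space[OF \<xi>_meas]
    by (intro measurable_vimage_algebra1) (auto simp: space_PiM)
  then have "(\<lambda>s. (\<lambda>k\<in>A. \<xi> k s) k) \<in> measurable (history M W \<xi> A) W"
    by (rule measurable_compose) (use assms in \<open>auto intro!: measurable_component_singleton\<close>)
  then show ?thesis
    using assms by simp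
qed

lemma measurable_history_mono:
  assumes g: "g \<in> measurable (history M W \<xi> A) N" and "A \<subseteq> B"
  shows "g \<in> measurable (history M W \<xi> B) N"
proof -
  have "(\<lambda>s. \<lambda>k\<in>A. \<xi> k s) \<in> measurable (history M W \<xi> B) (PiM A (\<lambda>_. W))"
    using assms(2) by (intro measurable_restrict measurable_history_component) auto
  then have "(\<lambda>s. s) \<in> measurable (history M W \<xi> B) (history M W \<xi> A)"
    unfolding history_def[of M W \<xi> A] by (intro measurable_vimage_algebra2) auto
  from measurable_compose[OF this g] show ?thesis .
qed

lemma measurable_id_history: "(\<lambda>s. s) \<in> measurable M (history M W \<xi> A)"
  unfolding history_def by (intro measurable_vimage_algebra2 measurable_restrict \<xi>_meas) auto

lemma measurable_of_history: "g \<in> measurable (history M W \<xi> A) N \<Longrightarrow> g \<in> measurable M N"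
  using measurable_compose[OF measurable_id_history] .

end

text \<open>Takes the place of conditional expectation: the part of \<open>q\<close> that depends on
  \<open>A\<close> is frozen while the noise in \<open>B\<close> is averaged. By independence the
  law of \<open>(s, s)\<close> on the product of the two histories is a product measure, and Tonelli
  applies.\<close>

lemma (in prob_space) nn_integral_disjoint_histories:
  assumes ind: "indep_vars (\<lambda>_. W) \<xi> UNIV" and AB: "A \<inter> B = {}"
    and q: "q \<in> borel_measurable (history M W \<xi> A \<Otimes>\<^sub>M history M W \<xi> B)"
  shows "(\<integral>\<^sup>+ s. q (s, s) \<partial>M) = (\<integral>\<^sup>+ s. (\<integral>\<^sup>+ s'. q (s, s') \<partial>M) \<partial>M)"
proof -
  let ?H = "history M W \<xi>" and ?X = "\<lambda>A s. \<lambda>k\<in>A. \<xi> k s"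
  have \<xi>: "\<xi> k \<in> measurable M W" for k
    using ind by (simp add: indep_vars_def)
  note id = measurable_id_history[of \<xi> M W, OF \<xi>]
  have ind': "indep_var (PiM A (\<lambda>_. W)) (?X A) (PiM B (\<lambda>_. W)) (?X B)"
    by (rule indep_var_restrict[OF ind AB]) auto
  \<comment> \<open>The identity into the history and the restricted family generate the same
    sigma-algebra, so independence passes from the families to the identity maps.\<close>
  have gen: "sigma_sets (space M) {(\<lambda>s. s) -` S \<inter> space M | S. S \<in> sets (?H A)}
      = sigma_sets (space M) {?X A -` S \<inter> space M | S. S \<in> sets (PiM A (\<lambda>_. W))}" for A
  proof -
    have "S \<inter> space M = S" if "S \<in> sets (?H A)" for S
      using sets.sets_into_space[OF that] by auto
    then have "{(\<lambda>s. s) -` S \<inter> space M | S. S \<in> sets (?H A)} = sets (?H A)"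
      by auto
    moreover have "sigma_sets (space M) (sets (?H A)) = sets (?H A)"
      using sets.sigma_sets_eq[of "?H A"] by simp
    ultimately show ?thesis
      by (simp add: history_def sets_vimage_algebra)
  qed
  have "indep_var (?H A) (\<lambda>s. s) (?H B) (\<lambda>s. s)"
    using ind' id unfolding indep_var_eq gen by simp
  then have D: "distr M (?H A) (\<lambda>s. s) \<Otimes>\<^sub>M distr M (?H B) (\<lambda>s. s)
      = distr M (?H A \<Otimes>\<^sub>M ?H B) (\<lambda>s. (s, s))"
    by (simp add: indep_var_distribution_eq)
  interpret B: prob_space "distr M (?H B) (\<lambda>s. s)"
    by (rule prob_space_distr) (rule id)
  have q1: "(\<lambda>s'. q (s, s')) \<in> borel_measurable (?H B)" if "s \<in> space M" for s
    using measurable_Pair2[OF q, of s] that by simp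
  have q2: "(\<lambda>s. \<integral>\<^sup>+ s'. q (s, s') \<partial>distr M (?H B) (\<lambda>s. s)) \<in> borel_measurable (?H A)"
    using q by (intro B.borel_measurable_nn_integral) (simp add: case_prod_beta cong: measurable_cong_sets)
  have "(\<integral>\<^sup>+ s. q (s, s) \<partial>M) = (\<integral>\<^sup>+ p. q p \<partial>distr M (?H A \<Otimes>\<^sub>M ?H B) (\<lambda>s. (s, s)))"
    using q by (intro nn_integral_distr[symmetric] measurable_Pair id) simp
  also have "\<dots> = (\<integral>\<^sup>+ s. (\<integral>\<^sup>+ s'. q (s, s') \<partial>distr M (?H B) (\<lambda>s. s)) \<partial>distr M (?H A) (\<lambda>s. s))"
    unfolding D[symmetric] using q
    by (subst B.nn_integral_fst[symmetric]) (auto cong: measurable_cong_sets)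
  also have "\<dots> = (\<integral>\<^sup>+ s. (\<integral>\<^sup>+ s'. q (s, s') \<partial>distr M (?H B) (\<lambda>s. s)) \<partial>M)"
    using id q2 by (intro nn_integral_distr) auto
  also have "\<dots> = (\<integral>\<^sup>+ s. (\<integral>\<^sup>+ s'. q (s, s') \<partial>M) \<partial>M)"
    using id q1 by (intro nn_integral_cong nn_integral_distr) auto
  finally show ?thesis .
qed

text \<open>Bias-variance decomposition: the mixed term has mean 0 because \<open>Y\<close> is
  centred.\<close>

lemma (in prob_space) second_moment_affine:
  fixes Y :: "'a \<Rightarrow> 'b::euclidean_space"
  assumes Y: "integrable M Y" "(\<integral>s. Y s \<partial>M) = 0" and Y2: "integrable M (\<lambda>s. (norm (Y s))\<^sup>2)"
  shows "integrable M (\<lambda>s. (norm (a + c *\<^sub>R Y s))\<^sup>2)"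
    and "(\<integral>s. (norm (a + c *\<^sub>R Y s))\<^sup>2 \<partial>M) = (norm a)\<^sup>2 + c\<^sup>2 * (\<integral>s. (norm (Y s))\<^sup>2 \<partial>M)"
proof -
  have eq: "(norm (a + c *\<^sub>R Y s))\<^sup>2 = (norm a)\<^sup>2 + 2 * c * inner a (Y s) + c\<^sup>2 * (norm (Y s))\<^sup>2" for s
    by (simp add: power2_norm_eq_inner algebra_simps inner_commute power2_eq_square[of c])
  have i: "integrable M (\<lambda>s. inner a (Y s))"
    using Y(1) by simp
  show "integrable M (\<lambda>s. (norm (a + c *\<^sub>R Y s))\<^sup>2)"
    unfolding eq using i Y2 by simp
  show "(\<integral>s. (norm (a + c *\<^sub>R Y s))\<^sup>2 \<partial>M) = (norm a)\<^sup>2 + c\<^sup>2 * (\<integral>s. (norm (Y s))\<^sup>2 \<partial>M)"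
    unfolding eq using i Y2 Y by (simp add: prob_space)
qed

lemma compressor_bias:
  fixes m v :: "'a::real_normed_vector"
  assumes "norm (m - v) \<le> \<eta> * norm v" and "0 \<le> \<alpha>" "\<alpha> \<le> 1"
  shows "norm (\<alpha> *\<^sub>R m - v) \<le> (1 - \<alpha> + \<alpha> * \<eta>) * norm v"
proof -
  have "\<alpha> *\<^sub>R m - v = \<alpha> *\<^sub>R (m - v) - (1 - \<alpha>) *\<^sub>R v"
    by (simp add: algebra_simps)
  also have "norm \<dots> \<le> \<alpha> * norm (m - v) + (1 - \<alpha>) * norm v"
    using norm_triangle_ineq4[of "\<alpha> *\<^sub>R (m - v)" "(1 - \<alpha>) *\<^sub>R v"] assms by simp
  also have "\<dots> \<le> \<alpha> * (\<eta> * norm v) + (1 - \<alpha>) * norm v"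
    using assms by (intro add_right_mono mult_left_mono)
  finally show ?thesis
    by (simp add: algebra_simps)
qed

text \<open>Bias \<open>v - \<alpha> *\<^sub>R m\<close> plus centred fluctuation
  \<open>- \<alpha> *\<^sub>R (Cop s v - m)\<close>. For \<open>\<alpha> = lam\<close> the factor is
  \<open>r\<close>.\<close>

lemma (in prob_space) compression_residual:
  fixes Cop :: "'a \<Rightarrow> 'b::euclidean_space \<Rightarrow> 'b"
  assumes C: "compressor_class M \<eta> \<omega> Cop" and \<alpha>: "0 \<le> \<alpha>" "\<alpha> \<le> 1"
  shows "integrable M (\<lambda>s. (norm (v - \<alpha> *\<^sub>R Cop s v))\<^sup>2)"
    and "(\<integral>s. (norm (v - \<alpha> *\<^sub>R Cop s v))\<^sup>2 \<partial>M) \<le> ((1 - \<alpha> + \<alpha> * \<eta>)\<^sup>2 + \<alpha>\<^sup>2 * \<omega>) * (norm v)\<^sup>2"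
proof -
  define m where "m = (\<integral>s. Cop s v \<partial>M)"
  have C1: "integrable M (\<lambda>s. Cop s v)" and C2: "integrable M (\<lambda>s. (norm (Cop s v - m))\<^sup>2)"
    and C3: "norm (m - v) \<le> \<eta> * norm v" and C4: "(\<integral>s. (norm (Cop s v - m))\<^sup>2 \<partial>M) \<le> \<omega> * (norm v)\<^sup>2"
    using C by (auto simp: compressor_class_def m_def)
  have Y: "integrable M (\<lambda>s. Cop s v - m)" "(\<integral>s. Cop s v - m \<partial>M) = 0"
    using C1 by (auto simp: m_def prob_space)
  have eq: "v - \<alpha> *\<^sub>R Cop s v = (v - \<alpha> *\<^sub>R m) + (- \<alpha>) *\<^sub>R (Cop s v - m)" for s
    by (simp add: algebra_simps)
  show "integrable M (\<lambda>s. (norm (v - \<alpha> *\<^sub>R Cop s v))\<^sup>2)"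
    unfolding eq by (rule second_moment_affine(1)[OF Y C2])
  have "(\<integral>s. (norm (v - \<alpha> *\<^sub>R Cop s v))\<^sup>2 \<partial>M)
      = (norm (\<alpha> *\<^sub>R m - v))\<^sup>2 + \<alpha>\<^sup>2 * (\<integral>s. (norm (Cop s v - m))\<^sup>2 \<partial>M)"
    unfolding eq second_moment_affine(2)[OF Y C2] by (simp add: norm_minus_commute)
  also have "\<dots> \<le> ((1 - \<alpha> + \<alpha> * \<eta>) * norm v)\<^sup>2 + \<alpha>\<^sup>2 * (\<omega> * (norm v)\<^sup>2)"
    using compressor_bias[OF C3 \<alpha>] C4 by (intro add_mono power_mono mult_left_mono) auto
  finally show "(\<integral>s. (norm (v - \<alpha> *\<^sub>R Cop s v))\<^sup>2 \<partial>M)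
      \<le> ((1 - \<alpha> + \<alpha> * \<eta>)\<^sup>2 + \<alpha>\<^sup>2 * \<omega>) * (norm v)\<^sup>2"
    by (simp only: power_mult_distrib mult.assoc distrib_right[of "_\<^sup>2"])
qed

text \<open>The same decomposition for the average over \<open>i\<close>: the biases add up by the
  triangle inequality, while the fluctuation of the average is controlled by
  \<open>\<omega>'\<close> directly. For \<open>\<omega>' = om_av\<close> the factor is
  \<open>r_av\<close>.\<close>

lemma (in prob_space) aggregated_compression_error:
  fixes Cop :: "nat \<Rightarrow> 'a \<Rightarrow> 'b::euclidean_space \<Rightarrow> 'b"
  assumes n: "n > 0" and C: "\<And>i. i < n \<Longrightarrow> compressor_class M \<eta> \<omega> (Cop i)"
    and var_int: "integrable M (\<lambda>s. (norm ((1 / real n) *\<^sub>R (\<Sum>i<n. Cop i s (v i) - (\<integral>s'. Cop i s' (v i) \<partial>M))))\<^sup>2)"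
    and var: "(\<integral>s. (norm ((1 / real n) *\<^sub>R (\<Sum>i<n. Cop i s (v i) - (\<integral>s'. Cop i s' (v i) \<partial>M))))\<^sup>2 \<partial>M)
      \<le> \<omega>' / real n * (\<Sum>i<n. (norm (v i))\<^sup>2)"
    and \<nu>: "0 \<le> \<nu>" "\<nu> \<le> 1"
  shows "integrable M (\<lambda>s. (norm ((1 / real n) *\<^sub>R (\<Sum>i<n. \<nu> *\<^sub>R Cop i s (v i) - v i)))\<^sup>2)"
    and "(\<integral>s. (norm ((1 / real n) *\<^sub>R (\<Sum>i<n. \<nu> *\<^sub>R Cop i s (v i) - v i)))\<^sup>2 \<partial>M)
      \<le> ((1 - \<nu> + \<nu> * \<eta>)\<^sup>2 + \<nu>\<^sup>2 * \<omega>') * ((1 / real n) * (\<Sum>i<n. (norm (v i))\<^sup>2))"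
proof -
  define m where "m i = (\<integral>s. Cop i s (v i) \<partial>M)" for i
  define Y where "Y s = (1 / real n) *\<^sub>R (\<Sum>i<n. Cop i s (v i) - m i)" for s
  define a where "a = (1 / real n) *\<^sub>R (\<Sum>i<n. \<nu> *\<^sub>R m i - v i)"
  have C1: "integrable M (\<lambda>s. Cop i s (v i))" and C2: "norm (m i - v i) \<le> \<eta> * norm (v i)" if "i < n" for i
    using C[OF that] by (auto simp: compressor_class_def m_def)
  have Y: "integrable M Y" "(\<integral>s. Y s \<partial>M) = 0"
  proof -
    have *: "integrable M (\<lambda>s. Cop i s (v i) - m i)" if "i < n" for i
      using C1[OF that] by simp
    then show "integrable M Y"
      unfolding Y_def by (intro integrable_scaleR_right integrable_sum) auto
    have "(\<integral>s. Cop i s (v i) - m i \<partial>M) = 0" if "i < n" for i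
      using C1[OF that] by (simp add: m_def prob_space)
    then show "(\<integral>s. Y s \<partial>M) = 0"
      unfolding Y_def using * by (simp add: integral_sum)
  qed
  have Y2: "integrable M (\<lambda>s. (norm (Y s))\<^sup>2)"
    using var_int by (simp add: Y_def m_def)
  have eq: "(1 / real n) *\<^sub>R (\<Sum>i<n. \<nu> *\<^sub>R Cop i s (v i) - v i) = a + \<nu> *\<^sub>R Y s" for s
  proof -
    have "(\<Sum>i<n. \<nu> *\<^sub>R Cop i s (v i) - v i)
        = (\<Sum>i<n. \<nu> *\<^sub>R m i - v i) + \<nu> *\<^sub>R (\<Sum>i<n. Cop i s (v i) - m i)"
      unfolding scaleR_right.sum sum.distrib[symmetric]
      by (intro sum.cong refl) (simp add: scaleR_diff_right)
    then show ?thesis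
      by (simp only: a_def Y_def scaleR_add_right scaleR_left_commute[of \<nu>])
  qed
  show "integrable M (\<lambda>s. (norm ((1 / real n) *\<^sub>R (\<Sum>i<n. \<nu> *\<^sub>R Cop i s (v i) - v i)))\<^sup>2)"
    unfolding eq by (rule second_moment_affine(1)[OF Y Y2])
  define \<beta> where "\<beta> = 1 - \<nu> + \<nu> * \<eta>"
  have "norm (\<Sum>i<n. \<nu> *\<^sub>R m i - v i) \<le> (\<Sum>i<n. \<beta> * norm (v i))"
    using compressor_bias[OF C2 \<nu>] by (intro sum_norm_le) (simp add: \<beta>_def)
  then have "(norm (\<Sum>i<n. \<nu> *\<^sub>R m i - v i))\<^sup>2 \<le> (\<Sum>i<n. \<beta> * norm (v i))\<^sup>2"
    by (intro power_mono) auto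
  \<comment> \<open>Cauchy-Schwarz costs a factor \<open>n\<close>; against
    \<open>(1 / real n)\<^sup>2\<close> this leaves an average.\<close>
  also have "\<dots> \<le> (\<Sum>i<n. (\<beta> * norm (v i))\<^sup>2) * real n"
    using sum_squared_le_sum_of_squares[of "\<lambda>i. \<beta> * norm (v i)" "{..<n}"] by simp
  also have "\<dots> = real n * \<beta>\<^sup>2 * (\<Sum>i<n. (norm (v i))\<^sup>2)"
    by (simp add: power_mult_distrib sum_distrib_left mult_ac)
  finally have "(norm a)\<^sup>2 \<le> (1 / real n)\<^sup>2 * (real n * \<beta>\<^sup>2 * (\<Sum>i<n. (norm (v i))\<^sup>2))"
    unfolding a_def norm_scaleR power_mult_distrib by (intro mult_mono) auto
  also have "\<dots> = \<beta>\<^sup>2 * ((1 / real n) * (\<Sum>i<n. (norm (v i))\<^sup>2))"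
    using n by (simp add: power2_eq_square)
  finally have a: "(norm a)\<^sup>2 \<le> \<beta>\<^sup>2 * ((1 / real n) * (\<Sum>i<n. (norm (v i))\<^sup>2))" .
  have "(\<integral>s. (norm (Y s))\<^sup>2 \<partial>M) \<le> \<omega>' * ((1 / real n) * (\<Sum>i<n. (norm (v i))\<^sup>2))"
    using var by (simp add: Y_def m_def)
  then have "\<nu>\<^sup>2 * (\<integral>s. (norm (Y s))\<^sup>2 \<partial>M) \<le> \<nu>\<^sup>2 * (\<omega>' * ((1 / real n) * (\<Sum>i<n. (norm (v i))\<^sup>2)))"
    by (intro mult_left_mono) auto
  then show "(\<integral>s. (norm ((1 / real n) *\<^sub>R (\<Sum>i<n. \<nu> *\<^sub>R Cop i s (v i) - v i)))\<^sup>2 \<partial>M)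
      \<le> ((1 - \<nu> + \<nu> * \<eta>)\<^sup>2 + \<nu>\<^sup>2 * \<omega>') * ((1 / real n) * (\<Sum>i<n. (norm (v i))\<^sup>2))"
    using a unfolding eq second_moment_affine(2)[OF Y Y2] \<beta>_def[symmetric] distrib_right
    by (simp only: mult.assoc)
qed

lemma norm_add_sq_le_young:
  fixes a b :: "'a::real_inner"
  assumes "s > 0"
  shows "(norm (a + b))\<^sup>2 \<le> (1 + s) * (norm a)\<^sup>2 + (1 + 1 / s) * (norm b)\<^sup>2"
proof -
  have "0 \<le> (norm (s *\<^sub>R a - b))\<^sup>2 / s"
    using assms by simp
  also have "\<dots> = s * (norm a)\<^sup>2 - 2 * inner a b + (norm b)\<^sup>2 / s"
    using assms by (simp add: power2_norm_eq_inner algebra_simps inner_commute add_divide_distrib diff_divide_distrib)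
  finally show ?thesis
    by (simp add: power2_norm_eq_inner algebra_simps inner_commute)
qed

text \<open>Young's inequality with weight \<open>s\<close> separates the memory error at the old
  point from the movement of the gradients, which the Lipschitz constants turn into displacement of
  the iterate.\<close>

lemma gradient_memory_drift:
  fixes g :: "nat \<Rightarrow> 'a::real_normed_vector \<Rightarrow> 'b::real_inner"
  assumes s: "s > 0" and lip: "\<And>i. i < n \<Longrightarrow> norm (g i y - g i x) \<le> L i * norm (y - x)"
  shows "(\<Sum>i<n. (norm (g i y - h i))\<^sup>2)
    \<le> (1 + s) * (\<Sum>i<n. (norm (g i x - h i))\<^sup>2) + (1 + 1 / s) * ((\<Sum>i<n. (L i)\<^sup>2) * (norm (y - x))\<^sup>2)"
proof -
  have "(norm (g i y - h i))\<^sup>2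
      \<le> (1 + s) * (norm (g i x - h i))\<^sup>2 + (1 + 1 / s) * ((L i)\<^sup>2 * (norm (y - x))\<^sup>2)" if "i < n" for i
  proof -
    have "(norm (g i y - g i x))\<^sup>2 \<le> (L i * norm (y - x))\<^sup>2"
      using lip[OF that] by (intro power_mono) auto
    then have "(1 + 1 / s) * (norm (g i y - g i x))\<^sup>2 \<le> (1 + 1 / s) * ((L i)\<^sup>2 * (norm (y - x))\<^sup>2)"
      using s by (intro mult_left_mono) (auto simp: power_mult_distrib)
    then show ?thesis
      using norm_add_sq_le_young[OF s, of "g i x - h i" "g i y - g i x"] by simp
  qed
  then have "(\<Sum>i<n. (norm (g i y - h i))\<^sup>2)
      \<le> (\<Sum>i<n. (1 + s) * (norm (g i x - h i))\<^sup>2 + (1 + 1 / s) * ((L i)\<^sup>2 * (norm (y - x))\<^sup>2))"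
    by (intro sum_mono) auto
  then show ?thesis
    by (simp only: sum.distrib sum_distrib_left sum_distrib_right)
qed

lemma convex_on_sum_functions:
  assumes "finite I" and "\<And>i. i \<in> I \<Longrightarrow> convex_on S (F i)" and "convex S"
  shows "convex_on S (\<lambda>y. \<Sum>i\<in>I. F i y)"
  using assms
proof (induction I rule: finite_induct)
  case empty
  then show ?case
    by (simp add: convex_on_const)
next
  case (insert j I)
  then have "convex_on S (\<lambda>y. F j y + (\<Sum>i\<in>I. F i y))"
    by (intro convex_on_add) auto
  then show ?case
    using insert.hyps by simp
qed

subsection \<open>Contraction of the Lyapunov function\<close>

text \<open>The mean is a nonnegative integral, so the bound includes its finiteness. All randomness
  of iteration \<open>k\<close> sits in \<open>\<xi> k\<close>, so compressors of one iteration may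
  depend on each other. The condition \<open>x0 \<in> D\<close> leaves out only an infinite initial
  value, for which the bound is trivial.\<close>

theorem theorem2:
  fixes M :: "'m measure" and W :: "'w measure"
    and \<xi> :: "nat \<Rightarrow> 'm \<Rightarrow> 'w"
    and C :: "nat \<Rightarrow> nat \<Rightarrow> 'w \<Rightarrow> 'a::euclidean_space \<Rightarrow> 'a"
    and n :: nat
    and fs :: "nat \<Rightarrow> 'a \<Rightarrow> real" and gf :: "nat \<Rightarrow> 'a \<Rightarrow> 'a"
    and f :: "'a \<Rightarrow> real" and gradf :: "'a \<Rightarrow> 'a"
    and Li :: "nat \<Rightarrow> real" and L Ltil :: real
    and D :: "'a set" and R :: "'a \<Rightarrow> real" and xstar :: 'a
    and \<mu> \<eta> om om_av lam nu \<gamma> r r_av sstar thstar :: real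
    and x0 :: 'a and h0 :: "nat \<Rightarrow> 'a"
    and x :: "nat \<Rightarrow> 'm \<Rightarrow> 'a" and h :: "nat \<Rightarrow> nat \<Rightarrow> 'm \<Rightarrow> 'a" and hb :: "nat \<Rightarrow> 'm \<Rightarrow> 'a"
    and \<Psi> :: "nat \<Rightarrow> 'm \<Rightarrow> real" and \<Psi>0 :: real
    and t :: nat
  assumes n_pos: "n > 0"
    (* the functions f_i and f *)
    and fs_convex: "\<And>i. i < n \<Longrightarrow> convex_on UNIV (fs i)"
    and fs_grad: "\<And>i y. i < n \<Longrightarrow> GDERIV (fs i) y :> gf i y"
    and fs_smooth: "\<And>i y z. i < n \<Longrightarrow> norm (gf i y - gf i z) \<le> Li i * norm (y - z)"
    and Ltil_def: "Ltil = sqrt ((1 / real n) * (\<Sum>i<n. (Li i)\<^sup>2))"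
    and f_def: "f = (\<lambda>y. (1 / real n) * (\<Sum>i<n. fs i y))"
    and gradf_def: "gradf = (\<lambda>y. (1 / real n) *\<^sub>R (\<Sum>i<n. gf i y))"
    and f_smooth: "\<And>y z. norm (gradf y - gradf z) \<le> L * norm (y - z)"
    and L_le: "L \<le> Ltil"
    (* the regularizer R, with effective domain D *)
    and R_pcc: "proper_closed_convex D R"
    and xstar_min: "xstar \<in> D" "\<And>y. y \<in> D \<Longrightarrow> f xstar + R xstar \<le> f y + R y"
    (* Kurdyka-Lojasiewicz condition *)
    and mu_pos: "\<mu> > 0"
    and KL: "\<And>y u. y \<in> D \<Longrightarrow> u \<in> subdiff D R y \<Longrightarrow>
               (norm (gradf y + u))\<^sup>2 \<ge> 2 * \<mu> * (f y + R y - f xstar - R xstar)"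
    (* randomness and compressors *)
    and M_prob: "prob_space M"
    and \<xi>_indep: "prob_space.indep_vars M (\<lambda>_. W) \<xi> UNIV"
    and C_meas: "\<And>t i. (\<lambda>(w, y). C t i w y) \<in> borel_measurable (W \<Otimes>\<^sub>M borel)"
    and eta_rng: "0 \<le> \<eta>" "\<eta> < 1" and om_nonneg: "0 \<le> om"
    and C_class: "\<And>t i. i < n \<Longrightarrow> compressor_class M \<eta> om (\<lambda>s. C t i (\<xi> t s))"
    and om_av_rng: "0 \<le> om_av" "om_av \<le> om"
    and om_av_int: "\<And>t (ys :: nat \<Rightarrow> 'a). integrable M (\<lambda>s.
          (norm ((1 / real n) *\<^sub>R (\<Sum>i<n. C t i (\<xi> t s) (ys i) - (\<integral>s'. C t i (\<xi> t s') (ys i) \<partial>M))))\<^sup>2)"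
    and om_av_bound: "\<And>t (ys :: nat \<Rightarrow> 'a). (\<integral>s.
          (norm ((1 / real n) *\<^sub>R (\<Sum>i<n. C t i (\<xi> t s) (ys i) - (\<integral>s'. C t i (\<xi> t s') (ys i) \<partial>M))))\<^sup>2 \<partial>M)
          \<le> om_av / real n * (\<Sum>i<n. (norm (ys i))\<^sup>2)"
    (* parameters *)
    and nu_rng: "0 < nu" "nu \<le> 1" and lam_rng: "0 < lam" "lam \<le> 1"
    and r_def: "r = (1 - lam + lam * \<eta>)\<^sup>2 + lam\<^sup>2 * om"
    and r_av_def: "r_av = (1 - nu + nu * \<eta>)\<^sup>2 + nu\<^sup>2 * om_av"
    and r_pos: "r > 0" and r_av_pos: "r_av > 0" and r_lt1: "r < 1"
    and sstar_def: "sstar = sqrt ((1 + r) / (2 * r)) - 1"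
    and thstar_def: "thstar = sstar * (1 + sstar) * r / r_av"
    and gamma_pos: "0 < \<gamma>"
    and gamma_le: "\<gamma> \<le> 1 / (2 * L + Ltil * sqrt (r_av / r) * (1 / sstar))"
    (* the EF-BV iteration *)
    and x0_dom: "x0 \<in> D"
    and it_x0: "\<And>s. s \<in> space M \<Longrightarrow> x 0 s = x0"
    and it_h0: "\<And>s i. s \<in> space M \<Longrightarrow> i < n \<Longrightarrow> h 0 i s = h0 i"
    and it_hb0: "\<And>s. s \<in> space M \<Longrightarrow> hb 0 s = (1 / real n) *\<^sub>R (\<Sum>i<n. h0 i)"
    and it_h: "\<And>s i k. s \<in> space M \<Longrightarrow> i < n \<Longrightarrow>
        h (Suc k) i s = h k i s + lam *\<^sub>R C k i (\<xi> k s) (gf i (x k s) - h k i s)"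
    and it_hb: "\<And>s k. s \<in> space M \<Longrightarrow>
        hb (Suc k) s = hb k s + lam *\<^sub>R ((1 / real n) *\<^sub>R (\<Sum>i<n. C k i (\<xi> k s) (gf i (x k s) - h k i s)))"
    and it_x: "\<And>s k. s \<in> space M \<Longrightarrow>
        x (Suc k) s = prox \<gamma> D R (x k s - \<gamma> *\<^sub>R
          (hb k s + nu *\<^sub>R ((1 / real n) *\<^sub>R (\<Sum>i<n. C k i (\<xi> k s) (gf i (x k s) - h k i s)))))"
    (* Lyapunov function *)
    and Psi_def: "\<And>k s. \<Psi> k s = f (x k s) + R (x k s) - f xstar - R xstar
        + \<gamma> / (2 * thstar) * ((1 / real n) * (\<Sum>i<n. (norm (gf i (x k s) - h k i s))\<^sup>2))"
    and Psi0_def: "\<Psi>0 = f x0 + R x0 - f xstar - R xstar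
        + \<gamma> / (2 * thstar) * ((1 / real n) * (\<Sum>i<n. (norm (gf i x0 - h0 i))\<^sup>2))"
  shows "(\<integral>\<^sup>+ s. ennreal (\<Psi> t s) \<partial>M)
           \<le> ennreal ((max (1 / (1 + \<gamma> * \<mu> / 2)) ((r + 1) / 2)) ^ t * \<Psi>0)"
proof -
  interpret prob_space M by (rule M_prob)

  \<comment> \<open>Smoothness, convexity and gradient of the average\<close>
  have L_nonneg: "0 \<le> L"
  proof -
    \<comment> \<open>A basis vector has norm 1, so the Lipschitz bound between it and 0 shows the
      sign of \<open>L\<close>.\<close>
    obtain e :: 'a where e: "e \<in> Basis"
      using nonempty_Basis by blast
    have "0 \<le> norm (gradf e - gradf 0)"
      by simp
    also have "\<dots> \<le> L * norm (e - 0)"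
      by (rule f_smooth)
    finally show ?thesis
      using e by simp
  qed
  have f_convex: "convex_on UNIV f"
    unfolding f_def using n_pos fs_convex
    by (intro convex_on_cmul convex_on_sum_functions) auto
  have f_grad: "GDERIV f y :> gradf y" for y
  proof -
    have "((\<lambda>y. (1 / real n) * (\<Sum>i<n. fs i y)) has_derivative
        (\<lambda>v. (1 / real n) * (\<Sum>i<n. inner v (gf i y)))) (at y)"
      using fs_grad by (intro has_derivative_mult_right has_derivative_sum) (auto simp: gderiv_def)
    then show ?thesis
      by (simp add: gderiv_def f_def gradf_def inner_sum_right)
  qed
  interpret KL_composite f gradf L D R xstar \<mu>
    using f_convex f_grad f_smooth R_pcc xstar_min(2) mu_pos KL by unfold_locales auto

  \<comment> \<open>Relations between the constants\<close>
  define c where "c = \<gamma> / (2 * thstar)"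
  define b where "b = \<gamma> * (Ltil * sqrt (r_av / r) * (1 / sstar))"
  define \<rho> where "\<rho> = max (1 / (1 + \<gamma> * \<mu> / 2)) ((r + 1) / 2)"
  have s_pos: "0 < sstar"
    using r_pos r_lt1 by (simp add: sstar_def less_divide_eq)
  \<comment> \<open>\<open>sstar\<close> is chosen so that inflating \<open>r\<close> by
    \<open>(1 + sstar)\<^sup>2\<close> gives the midpoint of \<open>r\<close> and 1.\<close>
  have s_sq: "(1 + sstar)\<^sup>2 * r = (1 + r) / 2"
    using r_pos by (simp add: sstar_def)
  have th_pos: "0 < thstar"
    using s_pos r_pos r_av_pos by (simp add: thstar_def)
  have c_pos: "0 < c"
    using gamma_pos th_pos by (simp add: c_def)
  \<comment> \<open>\<open>thstar\<close> is chosen for this identity: the mean gradient error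
    counts as \<open>sstar\<close> further copies of the weighted residual
    \<open>c * (1 + sstar) * r\<close>, and the two together give
    \<open>c * (1 + sstar)\<^sup>2 * r\<close>.\<close>
  have c_r_av: "\<gamma> / 2 * r_av = c * (sstar * (1 + sstar) * r)"
    using th_pos r_av_pos s_pos r_pos by (simp add: c_def thstar_def field_simps)
  have Ltil_nonneg: "0 \<le> Ltil"
    using L_nonneg L_le by simp
  have b_nonneg: "0 \<le> b"
    using gamma_pos Ltil_nonneg s_pos r_pos r_av_pos by (simp add: b_def)
  have Ltil_sq: "Ltil\<^sup>2 = (1 / real n) * (\<Sum>i<n. (Li i)\<^sup>2)"
    unfolding Ltil_def by (simp add: sum_nonneg)
  \<comment> \<open>The displacement kept by \<open>prox_step_le\<close> equals the one that the
    gradient drift, with Young weight \<open>sstar\<close>, adds to the memory term.\<close>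
  have b_sq: "b\<^sup>2 / (2 * \<gamma>) = c * ((1 + 1 / sstar) * Ltil\<^sup>2)"
  proof -
    have "b\<^sup>2 = \<gamma>\<^sup>2 * Ltil\<^sup>2 * (r_av / r) / sstar\<^sup>2"
      using r_pos r_av_pos by (simp add: b_def power_mult_distrib power_divide)
    then show ?thesis
      using gamma_pos s_pos r_pos r_av_pos
      by (simp add: c_def thstar_def power2_eq_square divide_simps) (simp add: algebra_simps)
  qed
  have step_size: "2 * (\<gamma> * L) + b \<le> 1"
  proof -
    \<comment> \<open>A vanishing denominator would make the quotient 0, so
      \<open>\<gamma> > 0\<close> forces it to be positive.\<close>
    have "0 < 1 / (2 * L + Ltil * sqrt (r_av / r) * (1 / sstar))"
      using gamma_pos gamma_le by linarith
    then have "\<gamma> * (2 * L + Ltil * sqrt (r_av / r) * (1 / sstar)) \<le> 1"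
      using gamma_le by (simp only: zero_less_divide_1_iff pos_le_divide_eq)
    then show ?thesis
      by (simp add: b_def algebra_simps)
  qed
  have \<rho>1: "1 / (1 + \<gamma> * \<mu> / 2) \<le> \<rho>" and \<rho>2: "1 / 2 \<le> \<rho>" and \<rho>3: "(1 + r) / 2 \<le> \<rho>"
    using r_pos by (auto simp: \<rho>_def le_max_iff_disj)

  \<comment> \<open>Feasibility of the iterates and mean of the memories\<close>
  have x_dom: "x k s \<in> D" if "s \<in> space M" for k s
    using that x0_dom it_x0 it_x prox_in_domain[OF R_pcc gamma_pos] by (cases k) auto
  have hb_mean: "hb k s = (1 / real n) *\<^sub>R (\<Sum>i<n. h k i s)" if s: "s \<in> space M" for k s
  proof (induction k)
    case 0
    then show ?case
      using s by (simp add: it_hb0 it_h0)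
  next
    case (Suc k)
    then show ?case
      using s by (simp add: it_hb it_h sum.distrib scaleR_add_right scaleR_right.sum[symmetric]
          scaleR_left_commute[of lam])
  qed

  \<comment> \<open>Error and residual of one iteration\<close>
  define v where "v k i s = gf i (x k s) - h k i s" for k i s
  define F where "F k s = gap (x k s)" for k s
  define G where "G k s = (1 / real n) * (\<Sum>i<n. (norm (v k i s))\<^sup>2)" for k s
  \<comment> \<open>The noise \<open>w\<close> of iteration \<open>k\<close> is kept apart from the
    sample point \<open>s\<close> that fixes the state, so that the two can be integrated
    separately. \<open>E\<close> is the error of the gradient estimate, \<open>Z\<close> the mean
    squared memory residual before the gradients move.\<close>
  define E where "E k s w = (1 / real n) *\<^sub>R (\<Sum>i<n. nu *\<^sub>R C k i w (v k i s) - v k i s)" for k s w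
  define Z where "Z k s w = (1 / real n) * (\<Sum>i<n. (norm (v k i s - lam *\<^sub>R C k i w (v k i s)))\<^sup>2)"
    for k s w
  define q where "q k s w = \<gamma> / 2 * (norm (E k s w))\<^sup>2 + c * (1 + sstar) * Z k s w" for k s w
  have \<Psi>_eq: "\<Psi> k s = F k s + c * G k s" for k s
    by (simp add: Psi_def F_def G_def v_def gap_def c_def)
  have F_nonneg: "0 \<le> F k s" if "s \<in> space M" for k s
    using gap_nonneg x_dom that by (simp add: F_def)
  have G_nonneg: "0 \<le> G k s" and Z_nonneg: "0 \<le> Z k s w" for k s w
    by (simp_all add: G_def Z_def sum_nonneg)
  have q_nonneg: "0 \<le> q k s w" for k s w
    using gamma_pos c_pos s_pos Z_nonneg by (simp add: q_def)

  \<comment> \<open>Pathwise descent\<close>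
  have descent: "\<Psi> (Suc k) s \<le> \<rho> * F k s + q k s (\<xi> k s)" if s: "s \<in> space M" for k s
  proof -
    define d where "d = hb k s + nu *\<^sub>R ((1 / real n) *\<^sub>R (\<Sum>i<n. C k i (\<xi> k s) (gf i (x k s) - h k i s)))"
    let ?\<Delta> = "(norm (x (Suc k) s - x k s))\<^sup>2"
    have "(\<Sum>i<n. nu *\<^sub>R C k i (\<xi> k s) (v k i s) - v k i s)
        = (\<Sum>i<n. h k i s) + nu *\<^sub>R (\<Sum>i<n. C k i (\<xi> k s) (gf i (x k s) - h k i s)) - (\<Sum>i<n. gf i (x k s))"
      by (simp add: v_def scaleR_right.sum sum.distrib sum_subtractf algebra_simps)
    then have "d - gradf (x k s) = E k s (\<xi> k s)"
      by (simp add: d_def hb_mean[OF s] gradf_def E_def scaleR_diff_right scaleR_add_right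
          scaleR_left_commute[of nu])
    moreover have "F (Suc k) s + b\<^sup>2 / (2 * \<gamma>) * ?\<Delta> \<le> \<rho> * F k s + \<gamma> / 2 * (norm (d - gradf (x k s)))\<^sup>2"
      unfolding F_def
      by (rule prox_step_le[OF gamma_pos x_dom[OF s] \<rho>1 \<rho>2 b_nonneg step_size L_nonneg])
        (simp add: it_x[OF s] d_def)
    ultimately have F: "F (Suc k) s + b\<^sup>2 / (2 * \<gamma>) * ?\<Delta> \<le> \<rho> * F k s + \<gamma> / 2 * (norm (E k s (\<xi> k s)))\<^sup>2"
      by simp
    \<comment> \<open>The residual is the distance from the old gradient to the new memory.\<close>
    have "v k i s - lam *\<^sub>R C k i (\<xi> k s) (v k i s) = gf i (x k s) - h (Suc k) i s" if "i < n" for i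
      using it_h[OF s that] by (simp add: v_def)
    then have Z: "Z k s (\<xi> k s) = (1 / real n) * (\<Sum>i<n. (norm (gf i (x k s) - h (Suc k) i s))\<^sup>2)"
      by (simp add: Z_def)
    have "(\<Sum>i<n. (norm (v (Suc k) i s))\<^sup>2)
        \<le> (1 + sstar) * (\<Sum>i<n. (norm (gf i (x k s) - h (Suc k) i s))\<^sup>2)
          + (1 + 1 / sstar) * ((\<Sum>i<n. (Li i)\<^sup>2) * ?\<Delta>)"
      unfolding v_def by (rule gradient_memory_drift[OF s_pos fs_smooth])
    then have "G (Suc k) s \<le> (1 / real n) * ((1 + sstar) * (\<Sum>i<n. (norm (gf i (x k s) - h (Suc k) i s))\<^sup>2)
          + (1 + 1 / sstar) * ((\<Sum>i<n. (Li i)\<^sup>2) * ?\<Delta>))"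
      unfolding G_def by (intro mult_left_mono) auto
    also have "\<dots> = (1 + sstar) * Z k s (\<xi> k s) + (1 + 1 / sstar) * (Ltil\<^sup>2 * ?\<Delta>)"
      unfolding Z Ltil_sq by (simp only: distrib_left mult_ac)
    finally have "c * G (Suc k) s \<le> c * ((1 + sstar) * Z k s (\<xi> k s) + (1 + 1 / sstar) * (Ltil\<^sup>2 * ?\<Delta>))"
      using c_pos by (intro mult_left_mono) auto
    \<comment> \<open>By \<open>b_sq\<close> the drift is exactly the displacement on the left of
      \<open>F\<close>, so it cancels in the sum.\<close>
    also have "\<dots> = c * (1 + sstar) * Z k s (\<xi> k s) + b\<^sup>2 / (2 * \<gamma>) * ?\<Delta>"
      unfolding b_sq by (simp only: distrib_left[of c "_ * _"] mult.assoc)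
    finally show ?thesis
      using F by (simp add: \<Psi>_eq q_def)
  qed

  \<comment> \<open>Mean of the noise terms for a frozen state\<close>
  have q_mean: "(\<integral>\<^sup>+ s'. ennreal (q k s (\<xi> k s')) \<partial>M) \<le> ennreal (\<rho> * (c * G k s))" for k s
  proof -
    note E_int = aggregated_compression_error[of n \<eta> om "\<lambda>i s'. C k i (\<xi> k s')" "\<lambda>i. v k i s" om_av nu,
        OF n_pos C_class om_av_int om_av_bound less_imp_le[OF nu_rng(1)] nu_rng(2), folded E_def G_def r_av_def]
    have E1: "integrable M (\<lambda>s'. (norm (E k s (\<xi> k s')))\<^sup>2)"
      and E2: "(\<integral>s'. (norm (E k s (\<xi> k s')))\<^sup>2 \<partial>M) \<le> r_av * G k s"
      using E_int by blast+
    note Z_int = compression_residual[OF C_class less_imp_le[OF lam_rng(1)] lam_rng(2), folded r_def]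
    have Z1: "integrable M (\<lambda>s'. Z k s (\<xi> k s'))"
      unfolding Z_def using Z_int(1) by (intro integrable_mult_right integrable_sum) auto
    have "(\<integral>s'. Z k s (\<xi> k s') \<partial>M)
        = (1 / real n) * (\<Sum>i<n. \<integral>s'. (norm (v k i s - lam *\<^sub>R C k i (\<xi> k s') (v k i s)))\<^sup>2 \<partial>M)"
      unfolding Z_def using Z_int(1) by (simp add: integral_sum)
    also have "\<dots> \<le> (1 / real n) * (\<Sum>i<n. r * (norm (v k i s))\<^sup>2)"
      using Z_int(2) by (intro mult_left_mono sum_mono) auto
    also have "\<dots> = r * G k s"
      by (simp add: G_def sum_distrib_left)
    finally have Z2: "(\<integral>s'. Z k s (\<xi> k s') \<partial>M) \<le> r * G k s" .
    have q_int: "integrable M (\<lambda>s'. q k s (\<xi> k s'))"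
      unfolding q_def using E1 Z1 by (intro Bochner_Integration.integrable_add integrable_mult_right) auto
    have "(\<integral>s'. q k s (\<xi> k s') \<partial>M)
        = \<gamma> / 2 * (\<integral>s'. (norm (E k s (\<xi> k s')))\<^sup>2 \<partial>M) + c * (1 + sstar) * (\<integral>s'. Z k s (\<xi> k s') \<partial>M)"
      unfolding q_def using E1 Z1 by simp
    also have "\<dots> \<le> (\<gamma> / 2 * r_av) * G k s + c * (1 + sstar) * (r * G k s)"
      unfolding mult.assoc[of "\<gamma> / 2"]
      using E2 Z2 gamma_pos c_pos s_pos by (intro add_mono mult_left_mono) auto
    also have "\<dots> = ((1 + sstar)\<^sup>2 * r) * (c * G k s)"
      unfolding c_r_av by (simp add: power2_eq_square algebra_simps)
    also have "\<dots> \<le> \<rho> * (c * G k s)"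
      unfolding s_sq using \<rho>3 c_pos G_nonneg by (intro mult_right_mono) auto
    finally show ?thesis
      using q_int q_nonneg by (simp add: nn_integral_eq_integral ennreal_leI)
  qed

  \<comment> \<open>Dependence of the state on the past\<close>
  have \<xi>_meas: "\<xi> k \<in> measurable M W" for k
    using \<xi>_indep by (simp add: indep_vars_def)
  let ?H = "history M W \<xi>"
  have C_comp: "(\<lambda>p. C k i (w p) (y p)) \<in> borel_measurable N"
    if "w \<in> measurable N W" "y \<in> borel_measurable N" for k i w y and N :: "'n measure"
    using measurable_compose[OF measurable_Pair[OF that] C_meas[of k i]] by simp
  have gf_comp: "(\<lambda>p. gf i (y p)) \<in> borel_measurable N"
    if "i < n" "y \<in> borel_measurable N" for i y and N :: "'m measure"
    using that fs_smooth
    by (intro measurable_compose[OF that(2) borel_measurable_continuous_onI]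
        lipschitz_imp_continuous_on[where L = "Li i"]) auto
  \<comment> \<open>The state at \<open>k\<close> uses only noise with index below \<open>k\<close>;
    the index set \<open>{..<k}\<close> is thus disjoint from \<open>{k}\<close>, the noise of the
    next update.\<close>
  have state_meas: "x k \<in> borel_measurable (?H {..<k}) \<and> hb k \<in> borel_measurable (?H {..<k})
      \<and> (\<forall>i<n. h k i \<in> borel_measurable (?H {..<k}))" for k
  proof (induction k)
    case 0
    have "x 0 \<in> borel_measurable (?H {..<0}) \<longleftrightarrow> (\<lambda>_. x0) \<in> borel_measurable (?H {..<0})"
      by (intro measurable_cong) (simp add: it_x0)
    moreover have "hb 0 \<in> borel_measurable (?H {..<0})
        \<longleftrightarrow> (\<lambda>_. (1 / real n) *\<^sub>R (\<Sum>i<n. h0 i)) \<in> borel_measurable (?H {..<0})"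
      by (intro measurable_cong) (simp add: it_hb0)
    moreover have "h 0 i \<in> borel_measurable (?H {..<0}) \<longleftrightarrow> (\<lambda>_. h0 i) \<in> borel_measurable (?H {..<0})"
      if "i < n" for i
      by (intro measurable_cong) (simp add: it_h0 that)
    ultimately show ?case
      by simp
  next
    case (Suc k)
    let ?N = "?H {..<Suc k}"
    note mono = measurable_history_mono[of \<xi> M W, OF \<xi>_meas, of _ "{..<k}" _ "{..<Suc k}"]
    have x_k: "x k \<in> borel_measurable ?N" and hb_k: "hb k \<in> borel_measurable ?N"
      by (rule mono; use Suc in auto)+
    have h_k: "h k i \<in> borel_measurable ?N" if "i < n" for i
      by (rule mono) (use Suc that in auto)
    have \<xi>_k: "\<xi> k \<in> measurable ?N W"
      by (rule measurable_history_component[of \<xi> M W, OF \<xi>_meas]) simp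
    have C_k: "(\<lambda>s. C k i (\<xi> k s) (gf i (x k s) - h k i s)) \<in> borel_measurable ?N" if "i < n" for i
      using that x_k h_k by (intro C_comp \<xi>_k borel_measurable_diff gf_comp) auto
    have mean: "(\<lambda>s. (1 / real n) *\<^sub>R (\<Sum>i<n. C k i (\<xi> k s) (gf i (x k s) - h k i s))) \<in> borel_measurable ?N"
      using C_k by (intro borel_measurable_scaleR borel_measurable_sum) auto
    have "(\<lambda>s. x k s - \<gamma> *\<^sub>R (hb k s + nu *\<^sub>R
        ((1 / real n) *\<^sub>R (\<Sum>i<n. C k i (\<xi> k s) (gf i (x k s) - h k i s))))) \<in> borel_measurable ?N"
      by (intro borel_measurable_diff borel_measurable_add borel_measurable_scaleR measurable_const x_k hb_k mean) simp_all
    from measurable_compose[OF this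
        borel_measurable_continuous_onI[OF continuous_on_prox[OF R_pcc gamma_pos]]]
    have "(\<lambda>s. prox \<gamma> D R (x k s - \<gamma> *\<^sub>R (hb k s + nu *\<^sub>R
        ((1 / real n) *\<^sub>R (\<Sum>i<n. C k i (\<xi> k s) (gf i (x k s) - h k i s)))))) \<in> borel_measurable ?N" .
    then have "x (Suc k) \<in> borel_measurable ?N"
      by (subst measurable_cong[OF it_x]) auto
    moreover have "hb (Suc k) \<in> borel_measurable ?N"
      using borel_measurable_add[OF hb_k borel_measurable_scaleR[OF borel_measurable_const mean]]
      by (subst measurable_cong[OF it_hb]) auto
    moreover have "h (Suc k) i \<in> borel_measurable ?N" if "i < n" for i
      using that by (subst measurable_cong[OF it_h])
        (auto intro!: borel_measurable_add borel_measurable_scaleR h_k C_k)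
    ultimately show ?case
      by blast
  qed
  have v_meas: "v k i \<in> borel_measurable (?H {..<k})" if "i < n" for k i
    unfolding v_def using state_meas[of k] that by (intro borel_measurable_diff gf_comp) auto
  note of_history = measurable_of_history[of \<xi> M W, OF \<xi>_meas]
  have F_meas: "F k \<in> borel_measurable M" for k
  proof -
    have x_k: "x k \<in> borel_measurable M"
      using state_meas[of k] by (intro of_history[of _ "{..<k}"]) simp
    have "(\<lambda>s. f (x k s)) \<in> borel_measurable M"
      by (rule measurable_compose[OF x_k borel_measurable_continuous_onI[OF continuous_on_f]])
    moreover have "(\<lambda>s. R (x k s)) \<in> borel_measurable M"
      by (rule borel_measurable_closed_convex_compose[OF R_pcc x_k x_dom])
    ultimately show ?thesis
      unfolding F_def gap_def by measurable
  qed
  have G_meas: "G k \<in> borel_measurable M" for k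
  proof -
    have "v k i \<in> borel_measurable M" if "i < n" for i
      by (rule of_history[OF v_meas[OF that]])
    then show ?thesis
      unfolding G_def
      by (intro borel_measurable_times borel_measurable_const borel_measurable_sum
          borel_measurable_power borel_measurable_norm) auto
  qed
  have q_meas: "(\<lambda>(s, s'). ennreal (q k s (\<xi> k s'))) \<in> borel_measurable (?H {..<k} \<Otimes>\<^sub>M ?H {k})" for k
  proof -
    let ?N = "?H {..<k} \<Otimes>\<^sub>M ?H {k}"
    have v1: "(\<lambda>p. v k i (fst p)) \<in> borel_measurable ?N" if "i < n" for i
      by (rule measurable_compose[OF measurable_fst v_meas[OF that]])
    have "(\<lambda>p. \<xi> k (snd p)) \<in> measurable ?N W"
      by (rule measurable_compose[OF measurable_snd measurable_history_component[of \<xi> M W, OF \<xi>_meas]]) simp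
    then have C1: "(\<lambda>p. C k i (\<xi> k (snd p)) (v k i (fst p))) \<in> borel_measurable ?N" if "i < n" for i
      using v1[OF that] by (rule C_comp)
    have "(\<lambda>p. E k (fst p) (\<xi> k (snd p))) \<in> borel_measurable ?N"
      unfolding E_def using v1 C1
      by (intro borel_measurable_scaleR borel_measurable_const borel_measurable_sum borel_measurable_diff) auto
    moreover have "(\<lambda>p. Z k (fst p) (\<xi> k (snd p))) \<in> borel_measurable ?N"
      unfolding Z_def using v1 C1
      by (intro borel_measurable_times borel_measurable_const borel_measurable_sum
          borel_measurable_power borel_measurable_norm borel_measurable_diff borel_measurable_scaleR) auto
    ultimately show ?thesis
      unfolding q_def case_prod_beta by measurable
  qed

  \<comment> \<open>Contraction in mean and its iteration\<close>
  have contraction: "(\<integral>\<^sup>+ s. ennreal (\<Psi> (Suc k) s) \<partial>M) \<le> ennreal \<rho> * (\<integral>\<^sup>+ s. ennreal (\<Psi> k s) \<partial>M)" for k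
  proof -
    have \<rho>_nonneg: "0 \<le> \<rho>"
      using \<rho>2 by simp
    note \<xi>_of = measurable_id_history[of \<xi> M W, OF \<xi>_meas]
    have q_M: "(\<lambda>s. ennreal (q k s (\<xi> k s))) \<in> borel_measurable M"
      using measurable_compose[OF measurable_Pair[OF \<xi>_of \<xi>_of] q_meas[of k]] by simp
    have "(\<integral>\<^sup>+ s. ennreal (\<Psi> (Suc k) s) \<partial>M) \<le> (\<integral>\<^sup>+ s. ennreal (\<rho> * F k s) + ennreal (q k s (\<xi> k s)) \<partial>M)"
      using descent \<rho>_nonneg F_nonneg q_nonneg
      by (intro nn_integral_mono) (auto simp: ennreal_plus[symmetric] intro!: ennreal_leI simp del: ennreal_plus)
    also have "\<dots> = (\<integral>\<^sup>+ s. ennreal (\<rho> * F k s) \<partial>M) + (\<integral>\<^sup>+ s. ennreal (q k s (\<xi> k s)) \<partial>M)"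
      using F_meas q_M by (intro nn_integral_add) auto
    \<comment> \<open>Independence of \<open>\<xi> k\<close> from the past replaces its value at
      \<open>s\<close> by a fresh sample \<open>s'\<close>, which makes \<open>q_mean\<close>
      applicable.\<close>
    also have "(\<integral>\<^sup>+ s. ennreal (q k s (\<xi> k s)) \<partial>M) = (\<integral>\<^sup>+ s. \<integral>\<^sup>+ s'. ennreal (q k s (\<xi> k s')) \<partial>M \<partial>M)"
      using nn_integral_disjoint_histories[OF \<xi>_indep _ q_meas[of k]] by simp
    also have "\<dots> \<le> (\<integral>\<^sup>+ s. ennreal (\<rho> * (c * G k s)) \<partial>M)"
      by (intro nn_integral_mono q_mean)
    also have "(\<integral>\<^sup>+ s. ennreal (\<rho> * F k s) \<partial>M) + (\<integral>\<^sup>+ s. ennreal (\<rho> * (c * G k s)) \<partial>M)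
        = (\<integral>\<^sup>+ s. ennreal (\<rho> * F k s) + ennreal (\<rho> * (c * G k s)) \<partial>M)"
      using F_meas G_meas by (intro nn_integral_add[symmetric]) auto
    also have "\<dots> = (\<integral>\<^sup>+ s. ennreal \<rho> * ennreal (\<Psi> k s) \<partial>M)"
      using \<rho>_nonneg F_nonneg G_nonneg c_pos
      by (intro nn_integral_cong)
        (simp add: \<Psi>_eq ennreal_plus[symmetric] ennreal_mult[symmetric] distrib_left del: ennreal_plus)
    also have "\<dots> = ennreal \<rho> * (\<integral>\<^sup>+ s. ennreal (\<Psi> k s) \<partial>M)"
      using F_meas G_meas by (intro nn_integral_cmult) (auto simp: \<Psi>_eq)
    finally show ?thesis
      by (simp add: add_left_mono)
  qed
  have "(\<integral>\<^sup>+ s. ennreal (\<Psi> t s) \<partial>M) \<le> ennreal (\<rho> ^ t * \<Psi>0)"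
  proof (induction t)
    case 0
    have "\<Psi> 0 s = \<Psi>0" if "s \<in> space M" for s
      using that by (simp add: Psi_def Psi0_def it_x0 it_h0)
    then have "(\<integral>\<^sup>+ s. ennreal (\<Psi> 0 s) \<partial>M) = (\<integral>\<^sup>+ s. ennreal \<Psi>0 \<partial>M)"
      by (intro nn_integral_cong) simp
    then show ?case
      by (simp add: emeasure_space_1)
  next
    case (Suc t)
    have "(\<integral>\<^sup>+ s. ennreal (\<Psi> (Suc t) s) \<partial>M) \<le> ennreal \<rho> * ennreal (\<rho> ^ t * \<Psi>0)"
      using contraction[of t] mult_left_mono[OF Suc, of "ennreal \<rho>"] by simp
    also have "\<dots> = ennreal (\<rho> ^ Suc t * \<Psi>0)"
      using \<rho>2 by (simp add: ennreal_mult'[symmetric] mult.assoc)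
    finally show ?case .
  qed
  then show ?thesis
    unfolding \<rho>_def .
qed

end
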